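(* Let $m\ge 2$ be an integer with $m\equiv 1\pmod 5$, let $f:\mathbb{Z}_5\to\mathbb{Z}_5$, $f(x)=x^m$, and let $t=\nu_5(m-1)$. 1. If $m\equiv 1\pmod{20}$, then the minimal decomposition of $\mathbb{Z}_5$ for $f$ is $$\mathbb{Z}_5=\{0,\pm1,\pm\mathfrak{i}\}\ \bigsqcup\ \Big(\bigcup_{l\ge0}\ \bigcup_{a=0}^{5^{t-1}-1}\ \bigcup_{i=1}^{4}\ \bigcup_{j=1}^{4}M_{l,a,i,j}\Big)\ \bigsqcup\ (5\mathbb{Z}_5\setminus\{0\}),$$ where $$M_{l,a,i,1}=1+5^{l+1}i+5^{l+2}a+5^{t+l+1}\mathbb{Z}_5,\qquad M_{l,a,i,2}=-1+5^{l+1}i+5^{l+2}a+5^{t+l+1}\mathbb{Z}_5,$$ $$M_{l,a,i,3}=\mathfrak{i}+5^{l+1}i+5^{l+2}a+5^{t+l+1}\mathbb{Z}_5,\qquad M_{l,a,i,4}=-\mathfrak{i}+5^{l+1}i+5^{l+2}a+5^{t+l+1}\mathbb{Z}_5.$$ Here $\{0,\pm1,\pm\mathfrak{i}\}$ is the set of periodic points (all of them fixed points), the $M_{l,a,i,j}$ are the minimal components, and $5\mathbb{Z}_5\setminus\{0\}$ is the attracting basin of the fixed point $0$. 2. If $m\equiv 6\pmod{10}$, then the minimal decomposition of $\mathbb{Z}_5$ for $f$ is $$\mathbb{Z}_5=\{0,1\}\ \bigsqcup\ \Big(\bigcup_{l\ge0}\ \bigcup_{a=0}^{5^{t-1}-1}\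 \bigcup_{i=1}^{4}M_{l,a,i}\Big)\ \bigsqcup\ \big((5\mathbb{Z}_5\setminus\{0\})\cup(2+5\mathbb{Z}_5)\cup(3+5\mathbb{Z}_5)\cup(4+5\mathbb{Z}_5)\big),$$ where $M_{l,a,i}=1+5^{l+1}i+5^{l+2}a+5^{t+l+1}\mathbb{Z}_5$. Here $\{0,1\}$ is the set of periodic points (all of them fixed points), the $M_{l,a,i}$ are the minimal components, $5\mathbb{Z}_5\setminus\{0\}$ is the attracting basin of the fixed point $0$, and $(2+5\mathbb{Z}_5)\cup(3+5\mathbb{Z}_5)\cup(4+5\mathbb{Z}_5)$ is the attracting basin of $1+5\mathbb{Z}_5$. 3. If $m\equiv 11\pmod{20}$, then the minimal decomposition of $\mathbb{Z}_5$ for $f$ is $$\mathbb{Z}_5=\{0,\pm1,\pm\mathfrak{i}\}\ \bigsqcup\ \Big(\bigcup_{l\ge0}\ \bigcup_{a=0}^{5^{t-1}-1}\ \bigcup_{i=1}^{4}\ \bigcup_{j=1}^{3}M_{l,a,i,j}\Big)\ \bigsqcup\ (5\mathbb{Z}_5\setminus\{0\}),$$ where $$M_{l,a,i,1}=1+5^{l+1}i+5^{l+2}a+5^{t+l+1}\mathbb{Z}_5,\qquad M_{l,a,i,2}=-1+5^{l+1}i+5^{l+2}a+5^{t+l+1}\mathbb{Z}_5,$$ $$M_{l,a,i,3}=(\mathfrak{i}+5^{l+1}i+5^{l+2}a+5^{t+l+1}\mathbb{Z}_5)\cup(-\mathfrak{i}-5^{l+1}i-5^{l+2}a+5^{t+l+1}\mathbb{Z}_5).$$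 Here $\{0,\pm1,\pm\mathfrak{i}\}$ is the set of periodic points, where $0,\pm1$ are fixed points and $\{\mathfrak{i},-\mathfrak{i}\}$ is a periodic orbit of period $2$; the $M_{l,a,i,j}$ are the minimal components; and $5\mathbb{Z}_5\setminus\{0\}$ is the attracting basin (the part $\mathcal{B}$ of the minimal decomposition).
   Context: $\mathbb{Z}_5$ is the ring of $5$-adic integers with its $5$-adic metric, and $\nu_5$ is the $5$-adic valuation. $\mathfrak{i}=2+5+2\cdot5^2+\cdots\in\mathbb{Z}_5$ denotes the square root of $-1$ in $\mathbb{Z}_5$ with $\mathfrak{i}\equiv 2\pmod 5$ (so $-\mathfrak{i}\equiv3\pmod 5$); it is distinct from the integer index $i$. For a polynomial $f$ over $\mathbb{Z}_p$, a minimal decomposition of $\mathbb{Z}_p$ for $f$ is a partition $\mathbb{Z}_p=\mathcal{P}\sqcup\mathcal{M}\sqcup\mathcal{B}$ where (1) $\mathcal{P}$ is the set of all periodic points of $f$; (2) $\mathcal{M}=\bigsqcup_i\mathcal{M}_i$ is a disjoint union of at most countably many clopen $f$-invariant sets, each a finite union of balls, such that each subsystem $f:\mathcal{M}_i\to\mathcal{M}_i$ is minimal (every forward orbit in $\mathcal{M}_i$ is dense in $\mathcal{M}_i$); the $\mathcal{M}_i$ are called minimal components; (3) each point of $\mathcal{B}$ lies in the attracting basin of a periodic orbit or of a minimal component. A point $x$ lies in the attracting basin of a closed invariant set $A$ if the distance from $f^n(x)$ to $A$ tends to $0$ as $n\to\infty$; in describing $\mathcal{B}$, the attracting set itself is not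 listed as part of its basin. *)

theory Defs
  imports "HOL-Analysis.Analysis" "HOL-Library.Set_Algebras" "HOL-Number_Theory.Cong"
begin

section \<open>The ring of 5-adic integers\<close>

text \<open>The inverse limit of the rings of integers modulo \<open>5 ^ n\<close>: an element is the coherent
  sequence of its least nonnegative residues.\<close>

typedef z5 = "{x :: nat \<Rightarrow> int. \<forall>n. x (Suc n) mod 5 ^ n = x n}"
  morphisms res Abs_z5
  by (rule exI[of _ "\<lambda>_. 0"]) simp

setup_lifting type_definition_z5

lemma res_Suc: "res x (Suc n) mod 5 ^ n = res x n"
  using res[of x] by simp

lemma res_mod [simp]: "res x n mod 5 ^ n = res x n"
  by (metis mod_mod_trivial res_Suc)

lemma res_coherent: "n \<le> k \<Longrightarrow> res x k mod 5 ^ n = res x n"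
proof (induction k rule: dec_induct)
  case (step k)
  then have "res x (Suc k) mod 5 ^ n = (res x (Suc k) mod 5 ^ k) mod 5 ^ n"
    by (simp add: le_imp_power_dvd mod_mod_cancel)
  then show ?case using step by (simp add: res_Suc)
qed simp

lemma mod_mod_pow5 [simp]: "(a :: int) mod (5 * 5 ^ n) mod 5 ^ n = a mod 5 ^ n"
  by (simp add: mod_mod_cancel)

instantiation z5 :: comm_ring_1
begin

lift_definition zero_z5 :: z5 is "\<lambda>_. 0" by simp

lift_definition one_z5 :: z5 is "\<lambda>n. 1 mod 5 ^ n" by simp

lift_definition plus_z5 :: "z5 \<Rightarrow> z5 \<Rightarrow> z5" is "\<lambda>x y n. (x n + y n) mod 5 ^ n"
  by simp (metis mod_add_eq)

lift_definition uminus_z5 :: "z5 \<Rightarrow> z5" is "\<lambda>x n. (- x n) mod 5 ^ n"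
  by simp (metis mod_minus_eq)

lift_definition minus_z5 :: "z5 \<Rightarrow> z5 \<Rightarrow> z5" is "\<lambda>x y n. (x n - y n) mod 5 ^ n"
  by simp (metis mod_diff_eq)

lift_definition times_z5 :: "z5 \<Rightarrow> z5 \<Rightarrow> z5" is "\<lambda>x y n. (x n * y n) mod 5 ^ n"
  by simp (metis mod_mult_eq)

instance
proof
  fix a b c :: z5
  show "a + b + c = a + (b + c)"
    by (rule res_inject[THEN iffD1]) (simp add: plus_z5.rep_eq mod_simps add.assoc)
  show "a + b = b + a"
    by (rule res_inject[THEN iffD1]) (simp add: plus_z5.rep_eq add.commute)
  show "0 + a = a"
    by (rule res_inject[THEN iffD1]) (simp add: plus_z5.rep_eq zero_z5.rep_eq)
  show "- a + a = 0"
    by (rule res_inject[THEN iffD1])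
      (simp add: plus_z5.rep_eq zero_z5.rep_eq uminus_z5.rep_eq mod_simps)
  show "a - b = a + - b"
    by (rule res_inject[THEN iffD1])
      (simp add: plus_z5.rep_eq minus_z5.rep_eq uminus_z5.rep_eq mod_simps)
  show "a * b * c = a * (b * c)"
    by (rule res_inject[THEN iffD1]) (simp add: times_z5.rep_eq mod_simps mult.assoc)
  show "a * b = b * a"
    by (rule res_inject[THEN iffD1]) (simp add: times_z5.rep_eq mult.commute)
  show "1 * a = a"
    by (rule res_inject[THEN iffD1]) (simp add: times_z5.rep_eq one_z5.rep_eq mod_simps)
  show "(a + b) * c = a * c + b * c"
    by (rule res_inject[THEN iffD1])
      (simp add: plus_z5.rep_eq times_z5.rep_eq mod_simps distrib_right)
  have "res (0 :: z5) 1 \<noteq> res 1 1"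
    by (simp add: zero_z5.rep_eq one_z5.rep_eq)
  then show "(0 :: z5) \<noteq> 1" by metis
qed

end

lemma z5_eqI: "(\<And>n. res x n = res y n) \<Longrightarrow> x = y"
  by (simp add: res_inject[symmetric] fun_eq_iff)

lemma res_of_nat: "res (of_nat k) n = int k mod 5 ^ n"
  by (induction k) (simp_all add: zero_z5.rep_eq one_z5.rep_eq plus_z5.rep_eq mod_simps)

lemma res_power: "res (x ^ k) n = res x n ^ k mod 5 ^ n"
  by (induction k) (simp_all add: one_z5.rep_eq times_z5.rep_eq mod_simps)

lemma res_numeral: "res (numeral k) n = numeral k mod 5 ^ n"
  using res_of_nat[of "numeral k" n] by simp

lemma pow5_dvd_iff: "5 ^ n dvd x \<longleftrightarrow> res x n = 0"
proof
  assume "5 ^ n dvd x"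
  then obtain y where "x = 5 ^ n * y" ..
  then show "res x n = 0"
    by (simp add: times_z5.rep_eq res_power res_numeral mod_simps)
next
  assume 0: "res x n = 0"
  define y where "y k = res x (n + k) div 5 ^ n" for k
  have mult: "5 ^ n * y k = res x (n + k)" for k
    using res_coherent[of n "n + k" x] 0 by (simp add: y_def mod_eq_0_iff_dvd)
  have "y (Suc k) mod 5 ^ k = y k" for k
  proof -
    have "5 ^ n * y k = (5 ^ n * y (Suc k)) mod (5 ^ n * 5 ^ k)"
      using res_Suc[of x "n + k"] by (simp only: mult add_Suc_right flip: power_add)
    also have "\<dots> = 5 ^ n * (y (Suc k) mod 5 ^ k)"
      by (rule mult_mod_right[symmetric])
    finally show ?thesis by simp
  qed
  then have res_y: "res (Abs_z5 y) = y"
    by (intro Abs_z5_inverse) blast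
  have "x = 5 ^ n * Abs_z5 y"
  proof (rule z5_eqI)
    fix k
    have "res x k = (5 ^ n * y k) mod 5 ^ k"
      by (simp add: mult res_coherent)
    then show "res x k = res (5 ^ n * Abs_z5 y) k"
      by (simp add: times_z5.rep_eq res_power res_numeral res_y mod_simps)
  qed
  then show "5 ^ n dvd x" by simp
qed

lemma bdd_pow5_dvd:
  assumes "x \<noteq> (0 :: z5)"
  obtains N where "\<And>n. 5 ^ n dvd x \<Longrightarrow> n < N"
proof -
  obtain N where N: "res x N \<noteq> 0"
    using assms z5_eqI[of x 0] by (auto simp: zero_z5.rep_eq)
  have "n < N" if "5 ^ n dvd x" for n
  proof (rule ccontr)
    assume "\<not> n < N"
    then have "res x N = 0"
      using that res_coherent[of N n x] by (simp add: pow5_dvd_iff)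
    then show False using N by simp
  qed
  then show ?thesis using that by blast
qed

subsection \<open>The 5-adic valuation and metric\<close>

text \<open>Only meaningful for nonzero arguments.\<close>

definition val5 :: "z5 \<Rightarrow> nat" where
  "val5 x = Max {n. 5 ^ n dvd x}"

definition abs5 :: "z5 \<Rightarrow> real" where
  "abs5 x = (if x = 0 then 0 else (1 / 5) ^ val5 x)"

lemma le_val5_iff:
  assumes "x \<noteq> 0"
  shows "n \<le> val5 x \<longleftrightarrow> 5 ^ n dvd x"
proof -
  let ?S = "{n. 5 ^ n dvd x}"
  obtain N where "\<And>n. 5 ^ n dvd x \<Longrightarrow> n < N"
    using bdd_pow5_dvd[OF assms] by blast
  then have fin: "finite ?S"
    by (intro finite_subset[of ?S "{..<N}"]) auto
  have "0 \<in> ?S" by simp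
  then have "val5 x \<in> ?S"
    unfolding val5_def using Max_in[OF fin] by blast
  then show ?thesis
    using Max_ge[OF fin, of n] by (auto simp: val5_def intro: power_le_dvd)
qed

lemma abs5_le_iff: "abs5 x \<le> (1 / 5) ^ n \<longleftrightarrow> 5 ^ n dvd x"
proof (cases "x = 0")
  case False
  then have "abs5 x \<le> (1 / 5) ^ n \<longleftrightarrow> n \<le> val5 x"
    by (simp add: abs5_def power_decreasing_iff del: power_one_over)
  then show ?thesis using False by (simp add: le_val5_iff)
qed (simp add: abs5_def)

lemma abs5_nonneg: "0 \<le> abs5 x"
  by (simp add: abs5_def)

lemma abs5_ultra: "abs5 (x + y) \<le> max (abs5 x) (abs5 y)"
proof (cases "x = 0 \<or> y = 0")
  case True
  then show ?thesis by (auto simp: max_def abs5_nonneg)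
next
  case False
  define n where "n = min (val5 x) (val5 y)"
  have "5 ^ n dvd x + y"
    using False by (intro dvd_add) (simp_all add: n_def flip: le_val5_iff)
  then have "abs5 (x + y) \<le> (1 / 5) ^ n"
    by (simp only: abs5_le_iff)
  also have "\<dots> \<le> max (abs5 x) (abs5 y)"
    using False by (auto simp: n_def min_def abs5_def)
  finally show ?thesis .
qed

lemma abs5_minus: "abs5 (- x) = abs5 x"
  by (simp add: abs5_def val5_def)

instantiation z5 :: metric_space
begin

definition dist_z5 :: "z5 \<Rightarrow> z5 \<Rightarrow> real" where
  "dist_z5 x y = abs5 (x - y)"

definition uniformity_z5 :: "(z5 \<times> z5) filter" where
  "uniformity_z5 = (INF e\<in>{0<..}. principal {(x, y). dist x y < e})"

definition open_z5 :: "z5 set \<Rightarrow> bool" where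
  "open_z5 U \<longleftrightarrow> (\<forall>x\<in>U. eventually (\<lambda>(x', y). x' = x \<longrightarrow> y \<in> U) uniformity)"

instance
proof
  fix x y z :: z5
  show "dist x y = 0 \<longleftrightarrow> x = y"
    by (simp add: dist_z5_def abs5_def)
  have "dist x y \<le> max (abs5 (x - z)) (abs5 (z - y))"
    using abs5_ultra[of "x - z" "z - y"] by (simp add: dist_z5_def)
  also have "\<dots> \<le> abs5 (x - z) + abs5 (z - y)"
    using abs5_nonneg[of "x - z"] abs5_nonneg[of "z - y"] by simp
  also have "\<dots> = dist x z + dist y z"
    using abs5_minus[of "z - y"] by (simp add: dist_z5_def)
  finally show "dist x y \<le> dist x z + dist y z" .
qed (simp_all add: uniformity_z5_def open_z5_def)

end

subsection \<open>The square root of -1 that is congruent to 2\<close>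

definition i5 :: z5 ("\<ii>\<^sub>5") where
  "\<ii>\<^sub>5 = (THE x. x ^ 2 = -1 \<and> 5 dvd (x - 2))"

lemma cong_pow5:
  fixes a b :: int
  assumes "[a = b] (mod 5 ^ Suc k)"
  shows "[a ^ 5 = b ^ 5] (mod 5 ^ Suc (Suc k))"
proof -
  have k: "5 ^ Suc k dvd a - b"
    using assms by (simp add: cong_iff_dvd_diff)
  then have "[a = b] (mod 5)"
    by (metis cong_iff_dvd_diff dvd_mult_left power_Suc)
  then have "[a ^ 4 + a ^ 3 * b + a ^ 2 * b ^ 2 + a * b ^ 3 + b ^ 4
      = b ^ 4 + b ^ 3 * b + b ^ 2 * b ^ 2 + b * b ^ 3 + b ^ 4] (mod 5)"
    by (intro cong_add cong_mult cong_pow cong_refl)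
  also have "b ^ 4 + b ^ 3 * b + b ^ 2 * b ^ 2 + b * b ^ 3 + b ^ 4 = 5 * b ^ 4"
    by algebra
  finally have "5 dvd a ^ 4 + a ^ 3 * b + a ^ 2 * b ^ 2 + a * b ^ 3 + b ^ 4"
    by (metis cong_dvd_iff dvd_triv_left)
  then have "5 ^ Suc k * 5 dvd (a - b) * (a ^ 4 + a ^ 3 * b + a ^ 2 * b ^ 2 + a * b ^ 3 + b ^ 4)"
    using k by (rule mult_dvd_mono[rotated])
  also have "\<dots> = a ^ 5 - b ^ 5" by algebra
  finally show ?thesis by (simp add: cong_iff_dvd_diff mult_ac)
qed

lemma ex1_i5: "\<exists>!x :: z5. x ^ 2 = -1 \<and> 5 dvd (x - 2)"
proof -
  define r :: "nat \<Rightarrow> int" where "r n = 2 ^ (5 ^ n)" for n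
  have r_Suc: "r (Suc n) = r n ^ 5" for n
    by (simp add: r_def power_mult[symmetric] mult.commute)
  have cong_r: "[r (Suc n) = r n] (mod 5 ^ Suc n)" for n
  proof (induction n)
    case 0
    show ?case by (simp add: r_def cong_def)
  next
    case (Suc n)
    show ?case using cong_pow5[OF Suc] by (simp only: r_Suc)
  qed
  have sq: "[r n ^ 2 = -1] (mod 5 ^ Suc n)" for n
  proof (induction n)
    case 0
    show ?case by (simp add: r_def cong_def)
  next
    case (Suc n)
    have "(r n ^ 2) ^ 5 = r (Suc n) ^ 2" by (simp add: r_Suc mult.commute flip: power_mult)
    then show ?case using cong_pow5[OF Suc] by simp
  qed
  define x where "x = Abs_z5 (\<lambda>n. r n mod 5 ^ n)"
  have "r (Suc n) mod 5 ^ n = r n mod 5 ^ n" for n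
    using cong_dvd_modulus[OF cong_r, of "5 ^ n" n] by (simp add: cong_def)
  then have res_x: "res x n = r n mod 5 ^ n" for n
    unfolding x_def by (subst Abs_z5_inverse) simp_all
  have "x ^ 2 = -1"
  proof (rule z5_eqI)
    fix n
    have "[r n ^ 2 = -1] (mod 5 ^ n)"
      using sq by (rule cong_dvd_modulus) simp
    then show "res (x ^ 2) n = res (-1) n"
      by (simp add: res_power res_x uminus_z5.rep_eq one_z5.rep_eq mod_simps cong_def)
  qed
  moreover have "5 dvd (x - 2)"
    using pow5_dvd_iff[of 1 "x - 2"]
    by (simp add: minus_z5.rep_eq res_x res_numeral r_def)
  moreover have "y = x" if y: "y ^ 2 = -1" "5 dvd (y - 2)" for y
  proof (rule z5_eqI)
    fix n
    have "5 ^ n dvd (y - x)" for n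
    proof (induction n)
      case (Suc n)
      then obtain w where w: "y - x = 5 ^ n * w" ..
      have "5 dvd (y - 2) + (x - 2) + 5"
        using y(2) \<open>5 dvd (x - 2)\<close> by (intro dvd_add) simp_all
      then obtain s where s: "y + x + 1 = 5 * s" by (auto elim!: dvdE simp: algebra_simps)
      have "(y - x) * (y + x) = 0"
        using y(1) \<open>x ^ 2 = -1\<close> by (simp add: power2_eq_square algebra_simps)
      then have "y - x = (y - x) * (y + x + 1)"
        by (simp only: distrib_left) simp
      then have "y - x = (y - x) * (5 * s)" by (simp only: s)
      then have "y - x = 5 ^ Suc n * (w * s)"
        by (simp only: w power_Suc) (simp add: mult_ac)
      then show ?case by simp
    qed simp
    then have "res (y - x) n = 0" by (simp add: pow5_dvd_iff)
    then have "[res y n = res x n] (mod 5 ^ n)"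
      by (simp add: minus_z5.rep_eq cong_iff_dvd_diff mod_eq_0_iff_dvd)
    then show "res y n = res x n" by (simp add: cong_def)
  qed
  ultimately show ?thesis by blast
qed

section \<open>Minimal decompositions\<close>

definition periodic_points :: "('a \<Rightarrow> 'a) \<Rightarrow> 'a set" where
  "periodic_points f = {x. \<exists>n>0. (f ^^ n) x = x}"

text \<open>The condition on the cardinality makes \<open>n\<close> the least period.\<close>

definition periodic_orbit :: "('a \<Rightarrow> 'a) \<Rightarrow> nat \<Rightarrow> 'a set \<Rightarrow> bool" where
  "periodic_orbit f n A \<longleftrightarrow>
     n > 0 \<and> card A = n \<and> (\<exists>x. (f ^^ n) x = x \<and> A = (\<lambda>k. (f ^^ k) x) ` {..<n})"

definition minimal_component :: "('a::metric_space \<Rightarrow> 'a) \<Rightarrow> 'a set \<Rightarrow> bool" where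
  "minimal_component f A \<longleftrightarrow>
     A \<noteq> {} \<and> open A \<and> closed A \<and> f ` A \<subseteq> A \<and>
     (\<exists>F. finite F \<and> (\<forall>(c, r)\<in>F. r > 0) \<and> A = (\<Union>(c, r)\<in>F. ball c r)) \<and>
     (\<forall>x\<in>A. A \<subseteq> closure (range (\<lambda>n. (f ^^ n) x)))"

text \<open>Used only for nonempty closed invariant \<open>A\<close>; \<open>infdist\<close> to the empty set is 0.\<close>

definition attracting_basin :: "('a::metric_space \<Rightarrow> 'a) \<Rightarrow> 'a set \<Rightarrow> 'a set" where
  "attracting_basin f A = {x. (\<lambda>n. infdist ((f ^^ n) x) A) \<longlonglongrightarrow> 0}"

text \<open>The components form a family over \<open>I\<close>; they are nonempty, so disjointness of the
  family also says that different indices give different components.\<close>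

definition minimal_decomposition ::
  "('a::metric_space \<Rightarrow> 'a) \<Rightarrow> 'a set \<Rightarrow> 'i set \<Rightarrow> ('i \<Rightarrow> 'a set) \<Rightarrow> 'a set \<Rightarrow> bool" where
  "minimal_decomposition f P I M B \<longleftrightarrow>
     P \<union> (\<Union>i\<in>I. M i) \<union> B = UNIV \<and>
     P \<inter> (\<Union>i\<in>I. M i) = {} \<and> P \<inter> B = {} \<and> (\<Union>i\<in>I. M i) \<inter> B = {} \<and>
     P = periodic_points f \<and>
     countable I \<and> disjoint_family_on M I \<and> (\<forall>i\<in>I. minimal_component f (M i)) \<and>
     (\<forall>x\<in>B. (\<exists>n A. periodic_orbit f n A \<and> x \<in> attracting_basin f A) \<or>
            (\<exists>i\<in>I. x \<in> attracting_basin f (M i)))"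

section \<open>The minimal components of the power maps\<close>

text \<open>The sets \<open>c + 5 ^ n \<int>\<^sub>5\<close>, in the notation of Set Algebras.\<close>

abbreviation coset5 :: "z5 \<Rightarrow> nat \<Rightarrow> z5 set" where
  "coset5 c n \<equiv> c +o ((5 ^ n) *o UNIV)"

text \<open>The components \<open>M l a i j\<close> of the three cases depend on \<open>t\<close>, the valuation of \<open>m - 1\<close>;
  values of \<open>j\<close> outside the index ranges are irrelevant.\<close>

definition M1 :: "nat \<Rightarrow> nat \<times> nat \<times> nat \<times> nat \<Rightarrow> z5 set" where
  "M1 t = (\<lambda>(l, a, i, j).
     if j = 1 then coset5 (1 + 5 ^ (l + 1) * of_nat i + 5 ^ (l + 2) * of_nat a) (t + l + 1)
     else if j = 2 then coset5 (- 1 + 5 ^ (l + 1) * of_nat i + 5 ^ (l + 2) * of_nat a) (t + l + 1)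
     else if j = 3 then coset5 (\<ii>\<^sub>5 + 5 ^ (l + 1) * of_nat i + 5 ^ (l + 2) * of_nat a) (t + l + 1)
     else coset5 (- \<ii>\<^sub>5 + 5 ^ (l + 1) * of_nat i + 5 ^ (l + 2) * of_nat a) (t + l + 1))"

definition M2 :: "nat \<Rightarrow> nat \<times> nat \<times> nat \<Rightarrow> z5 set" where
  "M2 t = (\<lambda>(l, a, i).
     coset5 (1 + 5 ^ (l + 1) * of_nat i + 5 ^ (l + 2) * of_nat a) (t + l + 1))"

definition M3 :: "nat \<Rightarrow> nat \<times> nat \<times> nat \<times> nat \<Rightarrow> z5 set" where
  "M3 t = (\<lambda>(l, a, i, j).
     if j = 1 then coset5 (1 + 5 ^ (l + 1) * of_nat i + 5 ^ (l + 2) * of_nat a) (t + l + 1)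
     else if j = 2 then coset5 (- 1 + 5 ^ (l + 1) * of_nat i + 5 ^ (l + 2) * of_nat a) (t + l + 1)
     else coset5 (\<ii>\<^sub>5 + 5 ^ (l + 1) * of_nat i + 5 ^ (l + 2) * of_nat a) (t + l + 1) \<union>
          coset5 (- \<ii>\<^sub>5 - 5 ^ (l + 1) * of_nat i - 5 ^ (l + 2) * of_nat a) (t + l + 1))"

end

theory Submission
  imports Defs
begin

text \<open>
  Every unit is \<open>x = c v\<close> with \<open>c ^ 4 = 1\<close> and \<open>v = 1 + 5 ^ k w\<close>, where \<open>k \<ge> 1\<close> and, unless
  \<open>v = 1\<close>, \<open>w\<close> is a unit. Since \<open>(1 + 5 ^ k w) ^ (5 ^ s n) = 1 + 5 ^ (k + s) (n w + 5 \<dots>)\<close> and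
  \<open>m = 1 + 5 ^ t q\<close> with \<open>5\<close> not dividing \<open>q\<close>, the map fixes \<open>v\<close> modulo \<open>5 ^ (k + t)\<close>, while
  its \<open>5 ^ s\<close>-th iterate moves \<open>v\<close> exactly at the digit of index \<open>k + t + s\<close>. Orbits thus
  approximate any point of the coset of \<open>x\<close> modulo \<open>5 ^ (k + t)\<close> digit by digit, as in an
  odometer. How the map permutes the four roots \<open>c\<close> depends on \<open>m\<close> modulo \<open>4\<close> only. The same
  expansion shows that \<open>1 + 5 \<int>\<^sub>5\<close> has no torsion, so periodic units are roots of unity.
\<close>

section \<open>Arithmetic of the 5-adic integers\<close>

lemma res_mult: "res (x * y) n = res x n * res y n mod 5 ^ n"
  by (simp add: times_z5.rep_eq)

lemma dvd5_iff: "5 dvd (x :: z5) \<longleftrightarrow> res x 1 = 0"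
  using pow5_dvd_iff[of 1 x] by simp

lemma pow5_dvd_diff_iff: "5 ^ n dvd x - y \<longleftrightarrow> res x n = res y n"
proof -
  have "5 ^ n dvd x - y \<longleftrightarrow> [res x n = res y n] (mod 5 ^ n)"
    by (simp add: pow5_dvd_iff minus_z5.rep_eq cong_iff_dvd_diff mod_eq_0_iff_dvd)
  then show ?thesis by (simp add: cong_def)
qed

lemma dvd5_diff_iff: "5 dvd (x :: z5) - y \<longleftrightarrow> res x 1 = res y 1"
  using pow5_dvd_diff_iff[of 1 x y] by simp

lemma res_1_cases: "res x 1 \<in> {0, 1, 2, 3, 4}"
proof -
  have "res x 1 = res x 1 mod 5" using res_mod[of x 1] by simp
  moreover have "0 \<le> res x 1 mod 5" "res x 1 mod 5 < 5" by simp_all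
  ultimately have "0 \<le> res x 1" "res x 1 < 5" by presburger+
  then show ?thesis by auto
qed

lemma dvd5_mult_iff: "5 dvd (x :: z5) * y \<longleftrightarrow> 5 dvd x \<or> 5 dvd y"
proof -
  have "res x 1 * res y 1 mod 5 = 0 \<longleftrightarrow> res x 1 = 0 \<or> res y 1 = 0"
    using res_1_cases[of x] res_1_cases[of y] by auto
  then show ?thesis by (simp add: dvd5_iff res_mult)
qed

lemma dvd5_power_iff: "5 dvd (x :: z5) ^ n \<longleftrightarrow> 5 dvd x \<and> n > 0"
proof (induction n)
  case 0
  show ?case by (simp add: dvd5_iff one_z5.rep_eq)
next
  case (Suc n)
  then show ?case by (auto simp: dvd5_mult_iff)
qed

lemma dvd5_of_nat_iff: "5 dvd (of_nat n :: z5) \<longleftrightarrow> 5 dvd n"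
  by (simp add: dvd5_iff res_of_nat) presburger

text \<open>Residue \<open>n + k\<close> of \<open>5 ^ n * z\<close> is \<open>5 ^ n\<close> times
  residue \<open>k\<close> of \<open>z\<close>. This special cancellation has to precede the proof
  that the ring is a domain.\<close>

lemma pow5_mult_eq_0:
  assumes "5 ^ n * (z :: z5) = 0"
  shows "z = 0"
proof (rule z5_eqI)
  fix k
  have "0 = res (5 ^ n * z) (n + k)" using assms by (simp add: zero_z5.rep_eq)
  also have "\<dots> = (5 ^ n * res z (n + k)) mod (5 ^ n * 5 ^ k)"
    by (simp add: res_mult res_power res_numeral mod_simps power_add)
  also have "\<dots> = 5 ^ n * (res z (n + k) mod 5 ^ k)" by (rule mult_mod_right[symmetric])
  also have "\<dots> = 5 ^ n * res z k" by (simp add: res_coherent)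
  finally show "res z k = res 0 k" by (simp add: zero_z5.rep_eq)
qed

text \<open>Maximality of the valuation makes the cofactor prime to 5. Indivisibility by 5 stands
  for being a unit throughout.\<close>

lemma pow5_decompose:
  assumes "(x :: z5) \<noteq> 0"
  obtains w where "x = 5 ^ val5 x * w" "\<not> 5 dvd w"
proof -
  have "5 ^ val5 x dvd x" using le_val5_iff[OF assms] by blast
  then obtain w where w: "x = 5 ^ val5 x * w" ..
  have "\<not> 5 dvd w"
  proof
    assume "5 dvd w"
    then have "5 ^ val5 x * 5 dvd 5 ^ val5 x * w" by (rule mult_dvd_mono[OF dvd_refl])
    then have "5 ^ Suc (val5 x) dvd x" by (metis w power_Suc mult.commute)
    then show False using le_val5_iff[OF assms, of "Suc (val5 x)"] by simp
  qed
  then show ?thesis using w that by blast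
qed

text \<open>Powers of 5 cancel, and a product of units is a unit because the residues modulo 5 form
  a field. From here on the cancellation rules of domains apply.\<close>

instance z5 :: idom
proof
  fix x y :: z5
  assume "x \<noteq> 0" "y \<noteq> 0"
  then obtain u v where u: "x = 5 ^ val5 x * u" "\<not> 5 dvd u" and v: "y = 5 ^ val5 y * v" "\<not> 5 dvd v"
    by (metis pow5_decompose)
  show "x * y \<noteq> 0"
  proof
    assume "x * y = 0"
    moreover have "x * y = 5 ^ (val5 x + val5 y) * (u * v)"
      by (subst u, subst v) (simp add: power_add mult_ac)
    ultimately have "u * v = 0" using pow5_mult_eq_0 by metis
    then show False using u(2) v(2) dvd5_mult_iff[of u v] by simp
  qed
qed

lemma five_neq_0: "(5 :: z5) \<noteq> 0"
  using pow5_mult_eq_0[of 1 1] by auto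

lemma pow5_dvd_pow5_mult: "5 ^ (n + k) dvd 5 ^ n * (x :: z5) \<longleftrightarrow> 5 ^ k dvd x"
  using five_neq_0 by (simp add: power_add)

section \<open>Powers of elements congruent to 1 modulo 5\<close>

lemma one_plus_power:
  fixes a :: "'a :: comm_semiring_1"
  shows "\<exists>b. (1 + a) ^ n = 1 + of_nat n * a + a ^ 2 * b"
proof (induction n)
  case 0
  show ?case by (rule exI[of _ 0]) simp
next
  case (Suc n)
  then obtain b where "(1 + a) ^ n = 1 + of_nat n * a + a ^ 2 * b" ..
  then have "(1 + a) ^ Suc n = 1 + of_nat (Suc n) * a + a ^ 2 * (of_nat n + b + a * b)"
    by (simp add: algebra_simps power2_eq_square)
  then show ?case ..
qed

text \<open>With \<open>a = 5 ^ k * w\<close>, every binomial term past the linear one is divisible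
  by \<open>5 ^ (k + 2)\<close>: the coefficients 10, 10 and 5 supply a factor 5 on top of
  \<open>a ^ 2\<close>, and \<open>a ^ 5\<close> supplies \<open>5 * k\<close> factors.\<close>

lemma one_plus_pow5_power5:
  fixes w :: "'a :: comm_semiring_1"
  assumes "k > 0"
  shows "\<exists>w'. (1 + 5 ^ k * w) ^ 5 = 1 + 5 ^ Suc k * (w + 5 * w')"
proof -
  obtain k' where k: "k = Suc k'" using assms by (cases k) auto
  \<comment> \<open>Since \<open>5 ^ k = 5 * p\<close>, the factor \<open>25 * p\<close> is
    \<open>5 ^ Suc k\<close>, and the expansion becomes a polynomial identity in \<open>p\<close>
    and \<open>w\<close>.\<close>
  define p where "p = (5 :: 'a) ^ k'"
  have pow5: "(1 + a) ^ 5 = 1 + 5 * a + 10 * a ^ 2 + 10 * a ^ 3 + 5 * a ^ 4 + a ^ 5" for a :: 'a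
    using binomial_ring[of a 1 5] by (simp add: eval_nat_numeral algebra_simps)
  have "(1 + 5 * p * w) ^ 5 = 1 + 25 * p * (w + 5 * (2 * p * w ^ 2 + 10 * p ^ 2 * w ^ 3
      + 25 * p ^ 3 * w ^ 4 + 25 * p ^ 4 * w ^ 5))"
    by (simp add: pow5 power_mult_distrib distrib_left mult_ac) (simp add: eval_nat_numeral ac_simps)
  then have "(1 + 5 ^ k * w) ^ 5 = 1 + 5 ^ Suc k * (w + 5 * (2 * p * w ^ 2 + 10 * p ^ 2 * w ^ 3
      + 25 * p ^ 3 * w ^ 4 + 25 * p ^ 4 * w ^ 5))"
    by (simp only: k power_Suc p_def) (simp add: mult.assoc)
  then show ?thesis ..
qed

text \<open>The exponent \<open>n\<close> multiplies the leading coefficient by \<open>n\<close>,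
  and each fifth power then shifts the deviation from 1 by one digit. The semiring version serves
  both 5-adic integers and natural exponents.\<close>

lemma one_plus_pow5_power:
  fixes w :: "'a :: comm_semiring_1"
  assumes "k > 0"
  shows "\<exists>w'. (1 + 5 ^ k * w) ^ (5 ^ s * n) = 1 + 5 ^ (k + s) * (of_nat n * w + 5 * w')"
proof (induction s)
  case 0
  obtain b where "(1 + 5 ^ k * w) ^ n = 1 + of_nat n * (5 ^ k * w) + (5 ^ k * w) ^ 2 * b"
    using one_plus_power by blast
  moreover obtain k' where k: "k = Suc k'" using assms by (cases k) auto
  ultimately have "(1 + 5 ^ k * w) ^ n = 1 + 5 ^ k * (of_nat n * w + 5 * (5 ^ k' * w ^ 2 * b))"
    by (simp add: algebra_simps power2_eq_square)
  then show ?case by auto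
next
  case (Suc s)
  then obtain w' where w': "(1 + 5 ^ k * w) ^ (5 ^ s * n) = 1 + 5 ^ (k + s) * (of_nat n * w + 5 * w')" ..
  obtain u where "(1 + 5 ^ (k + s) * (of_nat n * w + 5 * w')) ^ 5
      = 1 + 5 ^ Suc (k + s) * (of_nat n * w + 5 * w' + 5 * u)"
    using one_plus_pow5_power5[of "k + s"] assms by blast
  moreover have "(1 + 5 ^ k * w) ^ (5 ^ Suc s * n) = ((1 + 5 ^ k * w) ^ (5 ^ s * n)) ^ 5"
    by (simp add: mult_ac flip: power_mult)
  ultimately have "(1 + 5 ^ k * w) ^ (5 ^ Suc s * n)
      = 1 + 5 ^ (k + Suc s) * (of_nat n * w + 5 * (w' + u))"
    by (simp add: w' distrib_left add.assoc)
  then show ?case ..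
qed

text \<open>Otherwise \<open>v = 1 + 5 ^ k * w\<close> with a unit \<open>w\<close>. If
  \<open>n = 5 ^ s * q\<close> with \<open>q\<close> prime to 5, then \<open>v ^ n - 1\<close> is
  \<open>5 ^ (k + s)\<close> times an element congruent to the unit \<open>q * w\<close> modulo 5,
  so it cannot vanish.\<close>

lemma root_of_unity_trivial:
  assumes "5 dvd (v :: z5) - 1" "v ^ n = 1" "n > 0"
  shows "v = 1"
proof (rule ccontr)
  assume "v \<noteq> 1"
  then have nz: "v - 1 \<noteq> 0" by simp
  then obtain w where w: "v - 1 = 5 ^ val5 (v - 1) * w" "\<not> 5 dvd w" by (rule pow5_decompose)
  define k where "k = val5 (v - 1)"
  have k: "k > 0" using assms(1) le_val5_iff[OF nz, of 1] by (simp add: k_def)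
  obtain q where q: "n = 5 ^ multiplicity 5 n * q" "\<not> 5 dvd q"
    using multiplicity_decompose'[of n 5] assms(3) by auto
  define s where "s = multiplicity 5 n"
  have v: "v = 1 + 5 ^ k * w" using w(1) by (simp add: k_def algebra_simps)
  obtain w' where "(1 + 5 ^ k * w) ^ (5 ^ s * q) = 1 + 5 ^ (k + s) * (of_nat q * w + 5 * w')"
    using one_plus_pow5_power[OF k] by blast
  then have "1 = 1 + 5 ^ (k + s) * (of_nat q * w + 5 * w')"
    using assms(2) q(1) by (simp add: s_def v)
  then have "of_nat q * w + 5 * w' = 0" using five_neq_0 by simp
  then have "5 dvd of_nat q * w" by (metis dvd_0_right dvd_add_left_iff dvd_triv_left)
  then show False using w(2) q(2) by (simp add: dvd5_mult_iff dvd5_of_nat_iff)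
qed

section \<open>Fourth roots of unity and periodic points\<close>

lemma i5_sq: "\<ii>\<^sub>5 ^ 2 = - 1" and dvd5_i5: "5 dvd \<ii>\<^sub>5 - 2"
  using theI'[OF ex1_i5] by (simp_all add: i5_def)

lemma res_1_roots:
  "res 0 1 = 0" "res 1 1 = 1" "res (- 1) 1 = 4" "res \<ii>\<^sub>5 1 = 2" "res (- \<ii>\<^sub>5) 1 = 3"
  using dvd5_i5 by (simp_all add: dvd5_diff_iff zero_z5.rep_eq one_z5.rep_eq uminus_z5.rep_eq res_numeral)

text \<open>The Teichmueller representatives: one fourth root of unity for each nonzero residue
  modulo 5.\<close>

definition roots5 :: "z5 set" where
  "roots5 = {1, - 1, \<ii>\<^sub>5, - \<ii>\<^sub>5}"

lemma roots5_pow4: "c \<in> roots5 \<Longrightarrow> c ^ 4 = 1"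
  using i5_sq power_mult[of "\<ii>\<^sub>5" 2 2] by (auto simp: roots5_def)

lemma roots5_cong:
  assumes "\<not> 5 dvd x"
  shows "\<exists>c\<in>roots5. 5 dvd x - c"
proof -
  have "res x 1 \<in> (\<lambda>c. res c 1) ` roots5"
    using res_1_cases[of x] assms unfolding dvd5_iff roots5_def image_insert res_1_roots by blast
  then show ?thesis unfolding dvd5_diff_iff by blast
qed

lemma roots5_not_dvd: "c \<in> roots5 \<Longrightarrow> \<not> 5 dvd c"
  by (auto simp only: roots5_def dvd5_iff res_1_roots)

lemma mem_coset5: "x \<in> coset5 c n \<longleftrightarrow> 5 ^ n dvd x - c"
  by (auto simp: elt_set_plus_def elt_set_times_def dvd_def algebra_simps)

text \<open>Divide \<open>x\<close> by the root congruent to it. As \<open>x ^ (n - 1) = 1\<close>,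
  the quotient is a root of unity congruent to 1 modulo 5, hence it is 1.\<close>

lemma periodic_unit:
  assumes "\<not> 5 dvd x" "x ^ n = x" "n \<ge> 2"
  shows "x \<in> roots5"
proof -
  obtain c where c: "c \<in> roots5" "5 dvd x - c" using roots5_cong assms(1) by blast
  have c4: "c ^ 4 = 1" using c by (simp add: roots5_pow4)
  \<comment> \<open>\<open>c ^ 3\<close> is the inverse of \<open>c\<close>.\<close>
  define v where "v = x * c ^ 3"
  have "x * c ^ 3 - 1 = (x - c) * c ^ 3 + (c ^ 4 - 1)" by algebra
  then have v1: "5 dvd v - 1" using c(2) by (simp add: v_def c4)
  obtain k where k: "n = Suc k" "k > 0" using assms(3) by (cases n) auto
  have "x \<noteq> 0" using assms(1) by auto
  then have "x ^ k = 1" using assms(2) by (simp add: k)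
  then have "v ^ (k * 4) = (c ^ 4) ^ (3 * k)"
    by (simp add: v_def power_mult power_mult_distrib) (simp add: mult_ac flip: power_mult)
  then have "v = 1" using root_of_unity_trivial[OF v1, of "k * 4"] k by (simp add: c4)
  then have "x * (c ^ 3 * c) = c" by (simp add: v_def mult.assoc[symmetric])
  then have "x = c" using c4 by (simp flip: power_Suc2)
  then show ?thesis using c by simp
qed

lemma periodic_nonunit:
  assumes "5 dvd (x :: z5)" "x ^ n = x" "n \<ge> 2"
  shows "x = 0"
proof (rule ccontr)
  assume "x \<noteq> 0"
  obtain k where k: "n = Suc k" "k > 0" using assms(3) by (cases n) auto
  then have "x ^ k = 1" using assms(2) \<open>x \<noteq> 0\<close> by simp
  then show False using assms(1) k dvd5_power_iff[of x k] dvd5_iff[of 1] by (simp add: one_z5.rep_eq)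
qed

lemma res_bounds: "0 \<le> res x n" "res x n < 5 ^ n"
  using pos_mod_sign[of "5 ^ n" "res x n"] pos_mod_bound[of "5 ^ n" "res x n"] by simp_all

lemma pow5_mult_eq_iff:
  assumes "\<not> 5 dvd (u :: z5)" "\<not> 5 dvd v"
  shows "5 ^ a * u = 5 ^ b * v \<longleftrightarrow> a = b \<and> u = v"
proof -
  \<comment> \<open>One inequality, general enough to be applied again with the two sides
    exchanged.\<close>
  have "b \<le> a" if "5 ^ a * u = 5 ^ b * v" "\<not> 5 dvd u" for a b and u v :: z5
  proof (rule ccontr)
    assume "\<not> b \<le> a"
    then obtain d where "b = a + Suc d" by (metis less_imp_Suc_add not_le add_Suc_right)
    then have "5 ^ a * u = 5 ^ a * (5 * (5 ^ d * v))" using that(1) by (simp add: power_add mult_ac)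
    then have "u = 5 * (5 ^ d * v)" using five_neq_0 by simp
    then show False using that(2) by simp
  qed
  from this[of a u b v] this[of b v a u] have "a = b" if "5 ^ a * u = 5 ^ b * v"
    using assms that by (simp add: order.antisym)
  then show ?thesis using five_neq_0 by auto
qed

text \<open>With \<open>d = 5 ^ t\<close> it puts the exponent \<open>m ^ n\<close> of every iterate
  into the form that \<open>power_near_root\<close> requires.\<close>

lemma one_plus_mult_power: "\<exists>r. (1 + d * q) ^ n = 1 + d * (r :: nat)"
proof -
  obtain b where "(1 + d * q) ^ n = 1 + n * (d * q) + (d * q) ^ 2 * b"
    using one_plus_power[of "d * q" n] by auto
  then have "(1 + d * q) ^ n = 1 + d * (n * q + d * q ^ 2 * b)"
    by (simp add: algebra_simps power2_eq_square)
  then show ?thesis ..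
qed

section \<open>Orbits near a root of unity\<close>

text \<open>\<open>c ^ 3 * x\<close> is the quotient of \<open>x\<close> by \<open>c\<close> and is
  congruent to 1 modulo \<open>5 ^ k\<close>, so its powers can be expanded. The power of
  \<open>c\<close> stays symbolic, which covers fixed and interchanged roots alike.\<close>

lemma near_root_factor:
  assumes "k > 0" "(c :: z5) ^ 4 = 1" "x = c + 5 ^ k * w"
  shows "\<exists>w'. x ^ (1 + 5 ^ s * n)
           = c ^ (1 + 5 ^ s * n) * c ^ 3 * x * (1 + 5 ^ (k + s) * (of_nat n * (c ^ 3 * w) + 5 * w'))"
proof -
  define v where "v = 1 + 5 ^ k * (c ^ 3 * w)"
  obtain w' where w': "v ^ (5 ^ s * n) = 1 + 5 ^ (k + s) * (of_nat n * (c ^ 3 * w) + 5 * w')"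
    unfolding v_def using one_plus_pow5_power[OF assms(1)] by blast
  have "c * v = c + 5 ^ k * (c ^ 4 * w)"
    by (simp add: v_def algebra_simps power4_eq_xxxx power3_eq_cube)
  then have x: "x = c * v" using assms(2,3) by simp
  have "c ^ 3 * x = c ^ 4 * v" by (simp add: x power4_eq_xxxx power3_eq_cube mult_ac)
  then have v: "v = c ^ 3 * x" using assms(2) by simp
  have "x ^ (1 + 5 ^ s * n) = c ^ (1 + 5 ^ s * n) * v * v ^ (5 ^ s * n)"
    unfolding x power_mult_distrib power_add by (simp only: power_one_right mult_ac)
  also have "\<dots> = c ^ (1 + 5 ^ s * n) * c ^ 3 * x
      * (1 + 5 ^ (k + s) * (of_nat n * (c ^ 3 * w) + 5 * w'))"
    by (simp only: w') (simp only: v mult.assoc)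
  finally show ?thesis ..
qed

text \<open>The multiplier \<open>e\<close> records the action on the root: 1 for a fixed root, -1
  when the map negates it. Modulo \<open>5 ^ (k + t)\<close> the points near the root are multiplied
  by the same \<open>e\<close>.\<close>

lemma power_near_root:
  fixes x c e :: z5
  assumes "k > 0" "5 ^ k dvd x - c" "c ^ 4 = 1" "c ^ (1 + 5 ^ t * q) = e * c"
  shows "5 ^ (k + t) dvd x ^ (1 + 5 ^ t * q) - e * x"
proof -
  obtain w where "x - c = 5 ^ k * w" using assms(2) ..
  then have "x = c + 5 ^ k * w" by (simp add: algebra_simps)
  then obtain u where "x ^ (1 + 5 ^ t * q) = c ^ (1 + 5 ^ t * q) * c ^ 3 * x * (1 + 5 ^ (k + t) * u)"
    using near_root_factor[OF assms(1,3)] by blast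
  also have "c ^ (1 + 5 ^ t * q) * c ^ 3 = e * c ^ 4"
    by (simp only: assms(4)) (simp add: power4_eq_xxxx power3_eq_cube mult_ac)
  finally have "x ^ (1 + 5 ^ t * q) - e * x = 5 ^ (k + t) * (e * x * u)"
    by (simp add: assms(3) algebra_simps)
  then show ?thesis by simp
qed

text \<open>By Fermat \<open>b ^ 3\<close> inverts \<open>b\<close> modulo 5, so the residue of
  \<open>d * b ^ 3\<close> is a solution.\<close>

lemma solve_mod5:
  assumes "\<not> 5 dvd (b :: z5)"
  shows "\<exists>j::nat. 5 dvd d - of_nat j * b"
proof -
  define j where "j = nat (res (d * b ^ 3) 1)"
  have "int j = res (d * b ^ 3) 1" by (simp add: j_def res_bounds)
  then have j: "5 dvd d * b ^ 3 - of_nat j"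
    by (simp only: dvd5_diff_iff res_of_nat res_mod)
  have "res b 1 ^ 4 mod 5 = 1"
    using assms res_1_cases[of b] unfolding dvd5_iff by auto
  then have "5 dvd 1 - b ^ 4"
    by (simp only: dvd5_diff_iff res_power one_z5.rep_eq) simp
  then have "5 dvd d * (1 - b ^ 4) + (d * b ^ 3 - of_nat j) * b"
    using j by (intro dvd_add dvd_mult dvd_mult2)
  also have "d * (1 - b ^ 4) + (d * b ^ 3 - of_nat j) * b = d - of_nat j * b" by algebra
  finally show ?thesis ..
qed

lemma root_power_fixed: "c ^ m = c \<Longrightarrow> c ^ (m ^ n) = (c :: z5)"
  by (induction n) (simp_all add: power_mult)

text \<open>The iterates \<open>x ^ (m ^ (5 ^ s * j))\<close> move \<open>x\<close> by \<open>j * b * 5 ^ (k + t + s)\<close> up to higher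
  order, with \<open>b\<close> a unit, so one more digit of \<open>y\<close> can be matched.\<close>

lemma orbit_next_digit:
  fixes x y c :: z5
  assumes "k > 0" "t > 0" "5 ^ k dvd x - c" "\<not> 5 ^ Suc k dvd x - c" "c ^ 4 = 1"
    and m: "m = 1 + 5 ^ t * q" and "\<not> 5 dvd q" and "c ^ m = c"
    and y: "5 ^ (k + t + s) dvd y - x"
  shows "\<exists>n. 5 ^ (k + t + Suc s) dvd y - x ^ (m ^ n)"
proof -
  obtain w where w: "x - c = 5 ^ k * w" using assms(3) ..
  then have x: "x = c + 5 ^ k * w" by (simp add: algebra_simps)
  have w5: "\<not> 5 dvd w" using assms(4) pow5_dvd_pow5_mult[of k 1 w] by (simp add: w)
  have c5: "\<not> 5 dvd c" using assms(5) dvd5_power_iff[of c 4] dvd5_iff[of 1]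
    by (auto simp: one_z5.rep_eq)
  have "5 dvd x - c" using assms(1,3) by (metis dvd_power dvd_trans)
  then have x5: "\<not> 5 dvd x" using c5 by (metis dvd_diff_right_iff dvd_diff_commute)
  \<comment> \<open>The speed of the odometer: \<open>x\<close> times the leading coefficient of the
    deviation of \<open>x ^ (m - 1)\<close> from 1.\<close>
  define b where "b = of_nat q * x * (c ^ 3 * w)"
  have "\<not> 5 dvd b"
    using w5 c5 x5 assms(7) by (simp add: b_def dvd5_mult_iff dvd5_power_iff dvd5_of_nat_iff)
  moreover obtain d where d: "y - x = 5 ^ (k + t + s) * d" using y ..
  ultimately obtain j :: nat where j: "5 dvd d - of_nat j * b" using solve_mod5 by blast
  \<comment> \<open>Here the expansion is used over the natural numbers, for the exponent
    \<open>m ^ (5 ^ s * j)\<close> itself.\<close>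
  obtain q' where q': "m ^ (5 ^ s * j) = 1 + 5 ^ (t + s) * (j * q + 5 * q')"
    unfolding m using one_plus_pow5_power[OF assms(2), of q s j] by auto
  have c_fix: "c ^ (m ^ (5 ^ s * j)) = c" using assms(8) by (rule root_power_fixed)
  obtain w' where w': "x ^ (m ^ (5 ^ s * j)) = c * c ^ 3 * x *
      (1 + 5 ^ (k + (t + s)) * (of_nat (j * q + 5 * q') * (c ^ 3 * w) + 5 * w'))"
    using near_root_factor[OF assms(1,5) x, of "t + s" "j * q + 5 * q'"] c_fix by (metis q')
  have c4: "c * c ^ 3 = 1" using assms(5) by (simp flip: power_Suc)
  have "y - x ^ (m ^ (5 ^ s * j)) = (y - x)
      - 5 ^ (k + t + s) * (x * (of_nat (j * q + 5 * q') * (c ^ 3 * w) + 5 * w'))"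
    by (simp only: w' c4) (simp add: algebra_simps)
  also have "\<dots> = 5 ^ (k + t + s) * ((d - of_nat j * b) - 5 * (x * (of_nat q' * (c ^ 3 * w) + w')))"
    by (simp only: d b_def) (simp add: algebra_simps)
  finally have "y - x ^ (m ^ (5 ^ s * j))
      = 5 ^ (k + t + s) * ((d - of_nat j * b) - 5 * (x * (of_nat q' * (c ^ 3 * w) + w')))" .
  moreover have "5 dvd (d - of_nat j * b) - 5 * (x * (of_nat q' * (c ^ 3 * w) + w'))"
    by (rule dvd_diff[OF j dvd_triv_left])
  ultimately have "5 ^ (k + t + s) * 5 dvd y - x ^ (m ^ (5 ^ s * j))"
    by (simp only: mult_dvd_mono[OF dvd_refl])
  then show ?thesis by (intro exI[of _ "5 ^ s * j"]) (simp add: mult.commute)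
qed

text \<open>One more digit of \<open>y\<close> is matched at each step, restarting from the iterate
  reached so far. Consecutive iterations add up in the exponent of \<open>m\<close>.\<close>

lemma orbit_dense:
  fixes x y c :: z5
  assumes "k > 0" "t > 0" "5 ^ k dvd x - c" "\<not> 5 ^ Suc k dvd x - c" "c ^ 4 = 1"
    and m: "m = 1 + 5 ^ t * q" and "\<not> 5 dvd q" and "c ^ m = c"
    and y: "5 ^ (k + t) dvd y - x"
  shows "\<exists>n. 5 ^ s dvd y - x ^ (m ^ n)"
proof -
  have "\<exists>n. 5 ^ (k + t + s) dvd y - x ^ (m ^ n)"
  proof (induction s)
    case 0
    show ?case using y by (intro exI[of _ 0]) simp
  next
    case (Suc s)
    then obtain n where n: "5 ^ (k + t + s) dvd y - x ^ (m ^ n)" ..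
    obtain r where r: "m ^ n = 1 + 5 ^ t * r" unfolding m using one_plus_mult_power by blast
    have "5 ^ (k + t) dvd x ^ (m ^ n) - 1 * x"
      using power_near_root[OF assms(1,3,5), of t r 1] root_power_fixed[OF assms(8), of n]
      by (simp add: r)
    \<comment> \<open>As \<open>t > 0\<close>, the displacement does not touch the first nonzero
      digit of \<open>x - c\<close>, so the iterate has the same distance from \<open>c\<close> as
      \<open>x\<close>.\<close>
    then have "5 ^ Suc k dvd x ^ (m ^ n) - x"
      using assms(2) by (simp add: power_le_dvd del: power_Suc)
    moreover have "x ^ (m ^ n) - c = (x ^ (m ^ n) - x) + (x - c)" by simp
    ultimately have "5 ^ k dvd x ^ (m ^ n) - c" "\<not> 5 ^ Suc k dvd x ^ (m ^ n) - c"
      using assms(3,4) by (metis dvd_add dvd_mult_right power_Suc, metis dvd_add_right_iff)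
    from orbit_next_digit[OF assms(1,2) this assms(5-8) n]
    obtain n' where "5 ^ (k + t + Suc s) dvd y - (x ^ (m ^ n)) ^ (m ^ n')" ..
    then have "5 ^ (k + t + Suc s) dvd y - x ^ (m ^ (n + n'))" by (simp only: power_add power_mult)
    then show ?case ..
  qed
  then show ?thesis by (metis dvd_mult_right power_add)
qed

section \<open>Cosets as balls, and a criterion for minimality\<close>

lemma dist_z5_flip: "dist c x = abs5 (x - c)"
  by (metis dist_commute dist_z5_def)

text \<open>Nonzero distances are powers of 1/5, so a strict bound gains one digit over a weak one.
  Together with the closed version below this makes cosets clopen.\<close>

lemma coset5_ball: "coset5 c (Suc n) = ball c ((1 / 5) ^ n)"
proof -
  have "abs5 z < (1 / 5) ^ n \<longleftrightarrow> 5 ^ Suc n dvd z" for z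
  proof (cases "z = 0")
    case False
    then have "abs5 z < (1 / 5) ^ n \<longleftrightarrow> Suc n \<le> val5 z"
      by (simp add: abs5_def power_strict_decreasing_iff Suc_le_eq del: power_one_over)
    then show ?thesis by (simp only: le_val5_iff[OF False])
  qed (simp add: abs5_def)
  then show ?thesis
    unfolding ball_def dist_z5_flip
    by (intro set_eqI) (simp only: mem_coset5 mem_Collect_eq)
qed

lemma coset5_cball: "coset5 c n = cball c ((1 / 5) ^ n)"
  unfolding cball_def dist_z5_flip abs5_le_iff
  by (intro set_eqI) (simp only: mem_coset5 mem_Collect_eq)

text \<open>For a finite union of cosets of one level the topological conditions are automatic, and
  density becomes approximation modulo every \<open>5 ^ s\<close>.\<close>

lemma minimal_componentI:
  assumes A: "A = (\<Union>c\<in>C. coset5 c (Suc n))" and C: "finite C" "C \<noteq> {}"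
    and inv: "\<And>x. x \<in> A \<Longrightarrow> f x \<in> A"
    and dense: "\<And>x y s. x \<in> A \<Longrightarrow> y \<in> A \<Longrightarrow> \<exists>k. 5 ^ s dvd y - (f ^^ k) x"
  shows "minimal_component f A"
  unfolding minimal_component_def
proof (intro conjI ballI)
  have "c \<in> coset5 c (Suc n)" for c unfolding mem_coset5 by simp
  then show "A \<noteq> {}" using C unfolding A by blast
  show "open A" unfolding A coset5_ball by blast
  show "closed A" unfolding A coset5_cball using C by blast
  show "f ` A \<subseteq> A" using inv by blast
  show "\<exists>F. finite F \<and> (\<forall>(c, r)\<in>F. 0 < r) \<and> A = (\<Union>(c, r)\<in>F. ball c r)"
    using C(1) unfolding A coset5_ball by (intro exI[of _ "C \<times> {(1 / 5) ^ n}"]) auto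
next
  fix x assume x: "x \<in> A"
  show "A \<subseteq> closure (range (\<lambda>n. (f ^^ n) x))"
    unfolding closure_approachable subset_iff mem_Collect_eq
  proof (intro allI impI)
    fix y and e :: real assume y: "y \<in> A" and "e > 0"
    then obtain s where s: "(1 / 5) ^ s < e" using real_arch_pow_inv[of e "1 / 5"] by auto
    obtain k where "5 ^ s dvd y - (f ^^ k) x" using dense[OF x y] by blast
    then have "dist y ((f ^^ k) x) \<le> (1 / 5) ^ s" by (simp only: dist_z5_def abs5_le_iff)
    then have "dist ((f ^^ k) x) y < e" using s by (simp add: dist_commute)
    then show "\<exists>z\<in>range (\<lambda>n. (f ^^ n) x). dist z y < e" by blast
  qed
qed

section \<open>The minimal components\<close>

text \<open>The common shape of all components; the centre \<open>c\<close> ranges over the roots of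
  unity.\<close>

definition comp5 :: "nat \<Rightarrow> z5 \<Rightarrow> nat \<times> nat \<times> nat \<Rightarrow> z5 set" where
  "comp5 t c = (\<lambda>(l, a, i). coset5 (c + 5 ^ (l + 1) * of_nat i + 5 ^ (l + 2) * of_nat a) (t + l + 1))"

abbreviation (input) idx5 :: "nat \<Rightarrow> (nat \<times> nat \<times> nat) set" where
  "idx5 t \<equiv> UNIV \<times> {0..5 ^ (t - 1) - 1} \<times> {1..4}"

text \<open>In base 5, \<open>l + 1\<close> is the position of the first nonzero digit of
  \<open>x - c\<close>, \<open>i\<close> is that digit, and \<open>a\<close> encodes the next
  \<open>t - 1\<close> digits.\<close>

lemma mem_comp5_res:
  assumes "t > 0" "(l, a, i) \<in> idx5 t"
  shows "x \<in> comp5 t c (l, a, i) \<longleftrightarrow> (\<exists>w. x - c = 5 ^ (l + 1) * w \<and> res w t = int (i + 5 * a))"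
proof -
  obtain t' where t: "t = Suc t'" using assms(1) by (cases t) auto
  \<comment> \<open>The index ranges make \<open>i + 5 * a\<close> its own residue modulo
    \<open>5 ^ t\<close>.\<close>
  have "i + 5 * a < 5 ^ t" using assms(2) by (auto simp: t le_eq_less_or_eq)
  then have "int (i + 5 * a) < 5 ^ t" by (metis of_nat_less_iff of_nat_numeral of_nat_power)
  then have r: "res (of_nat (i + 5 * a)) t = int (i + 5 * a)"
    unfolding res_of_nat by (intro mod_pos_pos_trivial) auto
  have eq: "x - (c + 5 ^ (l + 1) * of_nat i + 5 ^ (l + 2) * of_nat a)
      = (x - c) - 5 ^ (l + 1) * of_nat (i + 5 * a)"
    by (simp add: algebra_simps)
  have 1: "x \<in> comp5 t c (l, a, i) \<longleftrightarrow> 5 ^ (l + 1 + t) dvd (x - c) - 5 ^ (l + 1) * of_nat (i + 5 * a)"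
    unfolding comp5_def prod.case mem_coset5 eq by (simp only: add_ac)
  have 2: "5 ^ (l + 1 + t) dvd 5 ^ (l + 1) * w - 5 ^ (l + 1) * of_nat (i + 5 * a)
      \<longleftrightarrow> res w t = int (i + 5 * a)" for w
    by (simp only: right_diff_distrib[symmetric] pow5_dvd_pow5_mult pow5_dvd_diff_iff r)
  have 3: "\<exists>w. x - c = 5 ^ (l + 1) * w" if "x \<in> comp5 t c (l, a, i)"
  proof -
    have "5 ^ (l + 1) dvd (x - c) - 5 ^ (l + 1) * of_nat (i + 5 * a)"
      using that unfolding 1 by (metis dvd_mult_left power_add)
    then have "5 ^ (l + 1) dvd x - c" by (metis dvd_diff_left_iff dvd_triv_left)
    then show ?thesis by (auto elim: dvdE)
  qed
  show ?thesis using 1 2 3 by metis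
qed

text \<open>The lowest digit of \<open>w\<close> is \<open>i\<close>, which lies between 1 and
  4.\<close>

lemma idx5_res_unit:
  assumes "t > 0" "(l, a, i) \<in> idx5 t" "res w t = int (i + 5 * a)"
  shows "\<not> 5 dvd w"
proof -
  have "res w 1 = int (i + 5 * a) mod 5"
    using res_coherent[of 1 t w] assms(1,3) by simp
  then show ?thesis using assms(2) by (auto simp: dvd5_iff simp del: One_nat_def)
qed

text \<open>The factorisation of \<open>x - c\<close> into a power of 5 and a unit is unique: the
  exponent gives \<open>l\<close>, and the unit modulo \<open>5 ^ t\<close> gives \<open>i\<close>
  and \<open>a\<close> as remainder and quotient by 5.\<close>

lemma disjoint_comp5: "t > 0 \<Longrightarrow> disjoint_family_on (comp5 t c) (idx5 t)"
proof -
  assume t: "t > 0"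
  have "(l, a, i) = (l', a', i')"
    if p: "(l, a, i) \<in> idx5 t" "(l', a', i') \<in> idx5 t"
      and x: "x \<in> comp5 t c (l, a, i)" "x \<in> comp5 t c (l', a', i')"
    for x l a i l' a' i'
  proof -
    obtain w where w: "x - c = 5 ^ (l + 1) * w" "res w t = int (i + 5 * a)"
      using mem_comp5_res[OF t p(1)] x(1) by blast
    obtain w' where w': "x - c = 5 ^ (l' + 1) * w'" "res w' t = int (i' + 5 * a')"
      using mem_comp5_res[OF t p(2)] x(2) by blast
    have "l + 1 = l' + 1 \<and> w = w'"
      using pow5_mult_eq_iff[OF idx5_res_unit[OF t p(1) w(2)] idx5_res_unit[OF t p(2) w'(2)]] w w'
      by metis
    then have "l = l'" "i + 5 * a = i' + 5 * a'" using w(2) w'(2) by auto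
    moreover have "i < 5" "i' < 5" using p by auto
    ultimately have "i = i'" by presburger
    then show ?thesis using \<open>l = l'\<close> \<open>i + 5 * a = i' + 5 * a'\<close> by simp
  qed
  then show ?thesis unfolding disjoint_family_on_def by (metis disjoint_iff prod_cases3)
qed

text \<open>Conversely, the indices are read off from any \<open>x\<close> congruent to
  \<open>c\<close> but different from it: \<open>l + 1\<close> is the valuation of
  \<open>x - c\<close>, and the unit part modulo \<open>5 ^ t\<close> is divided by 5 with
  remainder.\<close>

lemma UN_comp5:
  assumes t: "t > 0"
  shows "(\<Union>p\<in>idx5 t. comp5 t c p) = coset5 c 1 - {c}"
proof (intro equalityI subsetI)
  fix x assume "x \<in> (\<Union>p\<in>idx5 t. comp5 t c p)"
  then obtain l a i where p: "(l, a, i) \<in> idx5 t" and x: "x \<in> comp5 t c (l, a, i)"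
    by (metis UN_E prod_cases3)
  then obtain w where w: "x - c = 5 ^ (l + 1) * w" "res w t = int (i + 5 * a)"
    using mem_comp5_res[OF t p] by blast
  have "w \<noteq> 0" using idx5_res_unit[OF t p w(2)] by auto
  then have "x - c \<noteq> 0" using w(1) five_neq_0 by simp
  moreover have "x \<in> coset5 c 1" unfolding mem_coset5 using w(1) by simp
  ultimately show "x \<in> coset5 c 1 - {c}" by auto
next
  fix x assume "x \<in> coset5 c 1 - {c}"
  then have x: "x - c \<noteq> 0" "5 ^ 1 dvd x - c" unfolding Diff_iff mem_coset5 by auto
  obtain w where w: "x - c = 5 ^ val5 (x - c) * w" "\<not> 5 dvd w" using pow5_decompose[OF x(1)] .
  have "1 \<le> val5 (x - c)" using le_val5_iff[OF x(1), of 1] x(2) by blast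
  then obtain l where l: "val5 (x - c) = l + 1" by (metis add.commute le_Suc_ex)
  define r where "r = nat (res w t)"
  have r: "int r = res w t" using res_bounds by (simp add: r_def)
  have "int r < 5 ^ t" using r res_bounds by simp
  then have "r < 5 ^ t" by (metis of_nat_less_iff of_nat_numeral of_nat_power)
  then have "r < 5 * 5 ^ (t - 1)" using t by (simp flip: power_Suc)
  then have "r div 5 < 5 ^ (t - 1)" by (simp add: less_mult_imp_div_less mult.commute)
  moreover have "res w 1 = int r mod 5" using res_coherent[of 1 t w] t r by simp
  then have "int r mod 5 \<noteq> 0" using w(2) dvd5_iff by metis
  then have "r mod 5 \<noteq> 0" by presburger
  moreover have "r mod 5 < 5" by simp
  ultimately have p: "(l, r div 5, r mod 5) \<in> idx5 t" by (simp add: Suc_le_eq) linarith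
  have "x \<in> comp5 t c (l, r div 5, r mod 5)"
    unfolding mem_comp5_res[OF t p] using w(1) l r by (intro exI[of _ w]) simp
  then show "x \<in> (\<Union>p\<in>idx5 t. comp5 t c p)" using p by blast
qed

lemma funpow_power: "((\<lambda>x. x ^ m) ^^ n) x = (x :: 'a :: monoid_mult) ^ (m ^ n)"
  by (induction n) (simp_all add: mult.commute flip: power_mult)

lemma comp5_near_root:
  assumes "t > 0" "(l, a, i) \<in> idx5 t" "x \<in> comp5 t c (l, a, i)"
  shows "5 ^ Suc l dvd x - c" "\<not> 5 ^ Suc (Suc l) dvd x - c"
proof -
  obtain w where w: "x - c = 5 ^ (l + 1) * w" "res w t = int (i + 5 * a)"
    using mem_comp5_res[OF assms(1,2)] assms(3) by blast
  show "5 ^ Suc l dvd x - c" by (simp add: w(1))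
  show "\<not> 5 ^ Suc (Suc l) dvd x - c"
    using idx5_res_unit[OF assms(1,2) w(2)] pow5_dvd_pow5_mult[of "Suc l" 1 w] by (simp add: w(1))
qed

text \<open>Every point of a coset is a centre of it. The level \<open>Suc l + t\<close> is the
  precision up to which the map preserves points at this distance from \<open>c\<close>.\<close>

lemma mem_comp5_cong:
  assumes "x \<in> comp5 t c (l, a, i)"
  shows "y \<in> comp5 t c (l, a, i) \<longleftrightarrow> 5 ^ (Suc l + t) dvd y - x"
  using assms unfolding comp5_def prod.case mem_coset5 pow5_dvd_diff_iff by (simp add: add_ac)

text \<open>Invariance is \<open>power_near_root\<close> with multiplier 1, and density is
  \<open>orbit_dense\<close> with \<open>k = Suc l\<close>.\<close>

lemma minimal_comp5:
  assumes t: "t > 0" and p: "(l, a, i) \<in> idx5 t" and c4: "c ^ 4 = 1"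
    and m: "m = 1 + 5 ^ t * q" and q: "\<not> 5 dvd q" and cm: "c ^ m = c"
  shows "minimal_component (\<lambda>x. x ^ m) (comp5 t c (l, a, i))"
proof (rule minimal_componentI)
  show "comp5 t c (l, a, i)
      = (\<Union>b\<in>{c + 5 ^ (l + 1) * of_nat i + 5 ^ (l + 2) * of_nat a}. coset5 b (Suc (t + l)))"
    by (simp add: comp5_def)
next
  fix x assume x: "x \<in> comp5 t c (l, a, i)"
  then show "x ^ m \<in> comp5 t c (l, a, i)"
    using power_near_root[of "Suc l" x c t q 1] comp5_near_root[OF t p x] c4 cm
    by (simp add: m mem_comp5_cong[OF x])
next
  fix x y s assume x: "x \<in> comp5 t c (l, a, i)" and "y \<in> comp5 t c (l, a, i)"
  then have "5 ^ (Suc l + t) dvd y - x" by (simp only: mem_comp5_cong[OF x])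
  then show "\<exists>k. 5 ^ s dvd y - ((\<lambda>x. x ^ m) ^^ k) x"
    unfolding funpow_power using comp5_near_root[OF t p x]
    by (intro orbit_dense[OF _ t _ _ c4 m q cm]) auto
qed simp_all

text \<open>The map exchanges the component around \<open>c\<close> with its negative. Its second
  iterate fixes \<open>c\<close>, so orbits of the second iterate are dense in each half, and one
  extra application joins the halves. Oddness of \<open>m\<close> lets negation commute with the
  map.\<close>

lemma minimal_comp5_swap:
  assumes t: "t > 0" and p: "(l, a, i) \<in> idx5 t" and c4: "c ^ 4 = 1"
    and m: "m = 1 + 5 ^ t * q" and q: "\<not> 5 dvd q" and cm: "c ^ m = - c" and "odd m"
  shows "minimal_component (\<lambda>x. x ^ m) {x. x \<in> comp5 t c (l, a, i) \<or> - x \<in> comp5 t c (l, a, i)}"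
    (is "minimal_component _ {x. x \<in> ?K \<or> - x \<in> ?K}")
proof (rule minimal_componentI)
  define b where "b = c + 5 ^ (l + 1) * of_nat i + 5 ^ (l + 2) * of_nat a"
  have "5 ^ n dvd - x - b \<longleftrightarrow> 5 ^ n dvd x - (- b)" for x n
    by (metis dvd_minus_iff minus_diff_eq minus_diff_commute diff_minus_eq_add add.commute)
  moreover have "?K = coset5 b (Suc (t + l))" by (simp add: comp5_def b_def)
  ultimately show "{x. x \<in> ?K \<or> - x \<in> ?K} = (\<Union>b\<in>{b, - b}. coset5 b (Suc (t + l)))"
    by (intro set_eqI) (simp only: mem_coset5 mem_Collect_eq UN_insert UN_empty Un_iff Un_empty_right)
next
  \<comment> \<open>Multiplier -1 in \<open>power_near_root\<close>.\<close>
  have swap: "- (x ^ m) \<in> ?K" if x: "x \<in> ?K" for x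
  proof -
    have "5 ^ (Suc l + t) dvd x ^ m - (- 1) * x"
      using power_near_root[of "Suc l" x c t q "- 1"] comp5_near_root[OF t p x] c4 cm by (simp add: m)
    then have "5 ^ (Suc l + t) dvd - (x ^ m) - x"
      by (metis add.commute diff_minus_eq_add dvd_minus_iff minus_add_distrib mult_minus1
        uminus_add_conv_diff minus_diff_eq)
    then show ?thesis by (simp only: mem_comp5_cong[OF x])
  qed
  have odd: "(- x) ^ m = - (x ^ m)" for x :: z5 using \<open>odd m\<close> by simp
  show "x ^ m \<in> {x. x \<in> ?K \<or> - x \<in> ?K}" if "x \<in> {x. x \<in> ?K \<or> - x \<in> ?K}" for x
    using that swap[of x] swap[of "- x"] by (auto simp: odd)
  \<comment> \<open>The square keeps the same \<open>t\<close>: the new cofactor is prime to 5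
    because \<open>q\<close> and 2 are.\<close>
  have m2: "m ^ 2 = 1 + 5 ^ t * (q * (2 + 5 ^ t * q))"
    by (simp add: m power2_eq_square algebra_simps)
  have "5 dvd 5 ^ t * q" using t by simp
  then have "\<not> 5 dvd 2 + 5 ^ t * q" by presburger
  then have q2: "\<not> 5 dvd q * (2 + 5 ^ t * q)"
    using q prime_dvd_mult_iff[of 5 q "2 + 5 ^ t * q"] by auto
  have cm2: "c ^ (m ^ 2) = c" using cm \<open>odd m\<close> by (simp add: power2_eq_square power_mult)
  have half: "\<exists>n. 5 ^ s dvd y - x ^ (m ^ n)" if x: "x \<in> ?K" "y \<in> ?K" for x y s
  proof -
    have "5 ^ (Suc l + t) dvd y - x" using x by (simp only: mem_comp5_cong[OF x(1)])
    then have "\<exists>n. 5 ^ s dvd y - x ^ ((m ^ 2) ^ n)"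
      using comp5_near_root[OF t p x(1)]
      by (intro orbit_dense[OF _ t _ _ c4 m2 q2 cm2]) auto
    then show ?thesis by (metis power_mult)
  qed
  have oddn: "(- x) ^ (m ^ n) = - (x ^ (m ^ n))" for x :: z5 and n using \<open>odd m\<close> by simp
  have neg: "5 ^ s dvd - y - - z \<longleftrightarrow> 5 ^ s dvd y - z" for s and y z :: z5
    by (metis dvd_minus_iff minus_diff_eq minus_diff_minus)
  \<comment> \<open>To approach a point of the other half, apply the map once and approximate
    \<open>- y\<close> from \<open>- (x ^ m)\<close> inside \<open>?K\<close>.\<close>
  have opp: "\<exists>n. 5 ^ s dvd y - x ^ (m ^ n)" if x: "x \<in> ?K" "- y \<in> ?K" for x y s
  proof -
    obtain n where "5 ^ s dvd - y - (- (x ^ m)) ^ (m ^ n)"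
      using half[OF swap[OF x(1)] x(2)] by blast
    then have "5 ^ s dvd y - x ^ (m ^ Suc n)" unfolding oddn neg power_mult[symmetric] by simp
    then show ?thesis ..
  qed
  show "\<exists>k. 5 ^ s dvd y - ((\<lambda>x. x ^ m) ^^ k) x"
    if "x \<in> {x. x \<in> ?K \<or> - x \<in> ?K}" "y \<in> {x. x \<in> ?K \<or> - x \<in> ?K}" for x y s
    using that half[of x y s] half[of "- x" "- y" s] opp[of x y s] opp[of "- x" "- y" s]
    unfolding funpow_power oddn neg mem_Collect_eq minus_minus by blast
qed simp_all

lemma mem_coset5_1: "x \<in> coset5 c 1 \<longleftrightarrow> res x 1 = res c 1"
  unfolding mem_coset5 pow5_dvd_diff_iff ..

text \<open>A point of period \<open>n\<close> is fixed by the single power \<open>m ^ n\<close>,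
  which is at least 2. Only 0 and the four roots can satisfy this; which roots return depends on
  \<open>m\<close>.\<close>

lemma periodic_points_power:
  assumes "m \<ge> 2"
  shows "periodic_points (\<lambda>x :: z5. x ^ m) = {x \<in> insert 0 roots5. \<exists>n>0. x ^ (m ^ n) = x}"
proof -
  have "x \<in> insert 0 roots5" if "x ^ (m ^ n) = x" "n > 0" for x n
  proof -
    have "2 \<le> m ^ n" using assms that(2) self_le_power[of m n] by linarith
    then show ?thesis using periodic_unit periodic_nonunit that(1) by blast
  qed
  then show ?thesis by (auto simp: periodic_points_def funpow_power)
qed

section \<open>Attracting basins\<close>

text \<open>Powers of a unit are units and stay away from 0, while the valuation of
  \<open>x ^ (m ^ n)\<close> is at least \<open>n\<close> for a nonzero multiple \<open>x\<close> of
  5.\<close>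

lemma attracting_basin_0:
  assumes "m \<ge> 2"
  shows "attracting_basin (\<lambda>x :: z5. x ^ m) {0} = coset5 0 1"
proof (intro equalityI subsetI)
  fix x :: z5 assume "x \<in> attracting_basin (\<lambda>x :: z5. x ^ m) {0}"
  then have "(\<lambda>n. abs5 (x ^ (m ^ n))) \<longlonglongrightarrow> 0"
    by (simp add: attracting_basin_def funpow_power dist_z5_def)
  then have "eventually (\<lambda>n. abs5 (x ^ (m ^ n)) < 1 / 5) sequentially"
    by (rule order_tendstoD) simp
  then obtain n where "abs5 (x ^ (m ^ n)) < 1 / 5" by (auto simp: eventually_sequentially)
  then have "5 dvd x ^ (m ^ n)" using abs5_le_iff[of "x ^ (m ^ n)" 1] by simp
  then show "x \<in> coset5 0 1" unfolding mem_coset5 by (simp add: dvd5_power_iff)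
next
  fix x :: z5 assume "x \<in> coset5 0 1"
  then have x: "5 dvd x" unfolding mem_coset5 by simp
  have "abs5 (x ^ (m ^ n)) \<le> (1 / 5) ^ n" for n
  proof -
    have "n \<le> m ^ n" using assms power_gt_expt[of m n] by simp
    then have "5 ^ n dvd x ^ (m ^ n)" using x by (meson dvd_power_same le_imp_power_dvd dvd_trans)
    then show ?thesis by (simp only: abs5_le_iff)
  qed
  then have "(\<lambda>n. abs5 (x ^ (m ^ n))) \<longlonglongrightarrow> 0"
    by (intro tendsto_sandwich[OF _ _ tendsto_const LIMSEQ_power_zero[of "1 / 5"]])
      (auto simp: abs5_nonneg)
  then show "x \<in> attracting_basin (\<lambda>x :: z5. x ^ m) {0}"
    by (simp add: attracting_basin_def funpow_power dist_z5_def)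
qed

text \<open>Once an orbit has entered an invariant set, its distance to the set is exactly
  0.\<close>

lemma attracting_basin_absorb:
  assumes "\<And>x. x \<in> A \<Longrightarrow> f x \<in> A" "(f ^^ k) x \<in> A"
  shows "x \<in> attracting_basin f A"
proof -
  have "(f ^^ (n + k)) x \<in> A" for n using assms by (induction n) auto
  then have "infdist ((f ^^ n) x) A = 0" if "n \<ge> k" for n
    using that by (metis infdist_zero le_add_diff_inverse2)
  then have "eventually (\<lambda>n. infdist ((f ^^ n) x) A = 0) sequentially"
    by (auto simp: eventually_sequentially)
  then show ?thesis unfolding attracting_basin_def by (auto intro: tendsto_eventually)
qed

text \<open>The residues modulo 5 of 0 and of the four roots are distinct and exhaust all five
  classes.\<close>

lemma coset5_partition:
  "(\<Union>c\<in>roots5. coset5 c 1 - {c}) \<inter> coset5 0 1 = {}"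
  "(\<Union>c\<in>roots5. coset5 c 1 - {c}) \<inter> insert 0 roots5 = {}"
  "roots5 \<inter> coset5 0 1 = {}"
  "(\<Union>c\<in>roots5. coset5 c 1) \<union> coset5 0 1 = UNIV"
proof -
  have inj: "c = c'" if "c \<in> insert 0 roots5" "c' \<in> insert 0 roots5" "res c 1 = res c' 1" for c c'
    using that unfolding roots5_def by (elim insertE emptyE; simp only: res_1_roots)
  show "(\<Union>c\<in>roots5. coset5 c 1 - {c}) \<inter> coset5 0 1 = {}" "roots5 \<inter> coset5 0 1 = {}"
    unfolding disjoint_iff UN_iff Diff_iff mem_coset5_1
    using roots5_not_dvd by (metis dvd5_iff res_1_roots(1))+
  show "(\<Union>c\<in>roots5. coset5 c 1 - {c}) \<inter> insert 0 roots5 = {}"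
    unfolding disjoint_iff UN_iff Diff_iff mem_coset5_1 using inj by blast
  show "(\<Union>c\<in>roots5. coset5 c 1) \<union> coset5 0 1 = UNIV"
    using roots5_cong unfolding set_eq_iff Un_iff UN_iff mem_coset5 by auto
qed

section \<open>The decompositions\<close>

lemma UN_roots5: "(\<Union>c\<in>roots5. coset5 c 1 - {c}) = - (coset5 0 1 \<union> roots5)"
proof (intro equalityI subsetI)
  fix x assume "x \<in> (\<Union>c\<in>roots5. coset5 c 1 - {c})"
  then show "x \<in> - (coset5 0 1 \<union> roots5)"
    using disjoint_iff[THEN iffD1, OF coset5_partition(1)] disjoint_iff[THEN iffD1, OF coset5_partition(2)]
    by (meson ComplI UnE insertCI)
next
  fix x assume x: "x \<in> - (coset5 0 1 \<union> roots5)"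
  have "x \<in> (\<Union>c\<in>roots5. coset5 c 1) \<union> coset5 0 1" unfolding coset5_partition(4) ..
  then obtain c where "c \<in> roots5" "x \<in> coset5 c 1" using x by (metis ComplD UnE UnI1 UN_E)
  moreover have "x \<noteq> c" using x \<open>c \<in> roots5\<close> by auto
  ultimately show "x \<in> (\<Union>c\<in>roots5. coset5 c 1 - {c})" by (intro UN_I[of c]) simp_all
qed

lemma periodic_orbit_fixed: "f x = x \<Longrightarrow> periodic_orbit f 1 {x}"
  by (auto simp: periodic_orbit_def)

text \<open>Shared by both odd cases: all four roots are periodic, the components fill the remaining
  units, and only the basin of 0 is left. How components are indexed and why they are minimal
  remains open here.\<close>

lemma minimal_decomposition_odd:
  assumes "m \<ge> 2" and per: "\<And>c. c \<in> roots5 \<Longrightarrow> \<exists>n>0. c ^ (m ^ n) = c"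
    and "(\<Union>p\<in>I. M p) = (\<Union>c\<in>roots5. coset5 c 1 - {c})" "countable I" "disjoint_family_on M I"
    and "\<And>p. p \<in> I \<Longrightarrow> minimal_component (\<lambda>x. x ^ m) (M p)"
  shows "minimal_decomposition (\<lambda>x. x ^ m) {0, 1, - 1, \<ii>\<^sub>5, - \<ii>\<^sub>5} I M (coset5 0 1 - {0})"
proof -
  have "\<exists>n>0. (0 :: z5) ^ (m ^ n) = 0" using assms(1) by (intro exI[of _ 1]) simp
  then have "insert 0 roots5 = periodic_points (\<lambda>x. x ^ m)"
    using per by (auto simp: periodic_points_power[OF assms(1)])
  moreover have "periodic_orbit (\<lambda>x. x ^ m) 1 {0 :: z5}"
    using assms(1) by (intro periodic_orbit_fixed) simp
  ultimately show ?thesis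
    unfolding minimal_decomposition_def assms(3) roots5_def[symmetric]
  proof (intro conjI ballI)
    let ?W = "\<Union>c\<in>roots5. coset5 c 1 - {c}"
    show "insert 0 roots5 \<union> ?W \<union> (coset5 0 1 - {0}) = UNIV"
      unfolding UN_roots5 by blast
    show "insert 0 roots5 \<inter> ?W = {}" using coset5_partition(2) by blast
    show "insert 0 roots5 \<inter> (coset5 0 1 - {0}) = {}" using coset5_partition(3) by blast
    show "?W \<inter> (coset5 0 1 - {0}) = {}" using coset5_partition(1) by blast
  next
    fix x assume "x \<in> coset5 0 1 - {0}"
    then have "x \<in> attracting_basin (\<lambda>x. x ^ m) {0}" by (simp only: attracting_basin_0[OF assms(1)] Diff_iff)
    then show "(\<exists>n A. periodic_orbit (\<lambda>x. x ^ m) n A \<and> x \<in> attracting_basin (\<lambda>x. x ^ m) A)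
        \<or> (\<exists>i\<in>I. x \<in> attracting_basin (\<lambda>x. x ^ m) (M i))"
      using \<open>periodic_orbit (\<lambda>x. x ^ m) 1 {0 :: z5}\<close> by blast
  qed (use assms(4-) in blast)+
qed

section \<open>The three families expressed through \<open>comp5\<close>\<close>

lemma M2_eq: "M2 t = comp5 t 1"
  by (simp add: M2_def comp5_def)

text \<open>The roots are numbered as by the index \<open>j\<close> of \<open>M1\<close>, with the
  same default value, so that \<open>M1_eq\<close> holds for every \<open>j\<close>.\<close>

definition root5 :: "nat \<Rightarrow> z5" where
  "root5 j = (if j = 1 then 1 else if j = 2 then - 1 else if j = 3 then \<ii>\<^sub>5 else - \<ii>\<^sub>5)"

lemma M1_eq: "M1 t (l, a, i, j) = comp5 t (root5 j) (l, a, i)"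
  by (simp add: M1_def comp5_def root5_def)

lemma neg_coset5: "- x \<in> coset5 c n \<longleftrightarrow> x \<in> coset5 (- c) n"
proof -
  have "- x - c = - (x - - c)" by simp
  then show ?thesis unfolding mem_coset5 by (metis dvd_minus_iff)
qed

text \<open>The centres of the two cosets of the third kind are negatives of each other; this gives
  the symmetric form that \<open>minimal_comp5_swap\<close> handles.\<close>

lemma M3_eq:
  "M3 t (l, a, i, j) = (if j \<in> {1, 2} then comp5 t (root5 j) (l, a, i)
     else {x. x \<in> comp5 t \<ii>\<^sub>5 (l, a, i) \<or> - x \<in> comp5 t \<ii>\<^sub>5 (l, a, i)})"
proof (cases "j \<in> {1, 2}")
  case True
  then show ?thesis by (auto simp: M3_def comp5_def root5_def)
next
  case False
  define b where "b = \<ii>\<^sub>5 + 5 ^ (l + 1) * of_nat i + 5 ^ (l + 2) * of_nat a"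
  have "- \<ii>\<^sub>5 - 5 ^ (l + 1) * of_nat i - 5 ^ (l + 2) * of_nat a = - b" by (simp add: b_def)
  then have "M3 t (l, a, i, j) = coset5 b (t + l + 1) \<union> coset5 (- b) (t + l + 1)"
    unfolding M3_def b_def using False by simp
  moreover have "comp5 t \<ii>\<^sub>5 (l, a, i) = coset5 b (t + l + 1)"
    unfolding comp5_def b_def prod.case ..
  moreover have "coset5 b n \<union> coset5 (- b) n = {x. x \<in> coset5 b n \<or> - x \<in> coset5 b n}" for n
    unfolding neg_coset5 by blast
  ultimately show ?thesis using False by (simp only: if_False)
qed

lemma comp5_res:
  assumes "t > 0" "p \<in> idx5 t" "x \<in> comp5 t c p"
  shows "res x 1 = res c 1"
  using UN_comp5[OF assms(1), of c] assms(2,3) unfolding mem_coset5_1[symmetric] by blast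

lemma root5_props:
  "roots5 = root5 ` {1..4}" "j \<in> {1..4} \<Longrightarrow> root5 j \<in> roots5"
  "j \<in> {1..4} \<Longrightarrow> j' \<in> {1..4} \<Longrightarrow> res (root5 j) 1 = res (root5 j') 1 \<Longrightarrow> j = j'"
proof -
  have 4: "{1..4} = {1, 2, 3, 4 :: nat}" by auto
  show "roots5 = root5 ` {1..4}" unfolding 4 by (auto simp: roots5_def root5_def)
  then show "j \<in> {1..4} \<Longrightarrow> root5 j \<in> roots5" by blast
  show "j \<in> {1..4} \<Longrightarrow> j' \<in> {1..4} \<Longrightarrow> res (root5 j) 1 = res (root5 j') 1 \<Longrightarrow> j = j'"
    using res_1_roots unfolding 4 by (auto simp: root5_def simp del: One_nat_def)
qed

lemma UN_quadruples:
  "(\<Union>p\<in>X \<times> Y \<times> Z \<times> J. F p) = {x. \<exists>p\<in>X \<times> Y \<times> Z. \<exists>j\<in>J. x \<in> (case p of (l, a, i) \<Rightarrow> F (l, a, i, j))}"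
  by fastforce

lemma UN_M1:
  assumes "t > 0"
  shows "(\<Union>p\<in>UNIV \<times> {0..5 ^ (t - 1) - 1} \<times> {1..4} \<times> {1..4}. M1 t p)
    = (\<Union>c\<in>roots5. coset5 c 1 - {c})"
proof -
  have "(\<Union>p\<in>UNIV \<times> {0..5 ^ (t - 1) - 1} \<times> {1..4} \<times> {1..4}. M1 t p)
      = (\<Union>j\<in>{1..4}. \<Union>p\<in>idx5 t. comp5 t (root5 j) p)"
    unfolding UN_quadruples M1_eq case_prod_eta by blast
  then show ?thesis by (simp only: UN_comp5[OF assms] root5_props(1) image_image)
qed

text \<open>The third kind accounts for two roots, since negation carries the punctured coset of
  \<open>\<ii>\<^sub>5\<close> to that of \<open>- \<ii>\<^sub>5\<close>.\<close>

lemma UN_M3: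
  assumes "t > 0"
  shows "(\<Union>p\<in>UNIV \<times> {0..5 ^ (t - 1) - 1} \<times> {1..4} \<times> {1..3}. M3 t p)
    = (\<Union>c\<in>roots5. coset5 c 1 - {c})"
proof -
  have 3: "{1..3} = {1, 2, 3 :: nat}" by auto
  have "(case p of (l, a, i) \<Rightarrow> M3 t (l, a, i, 1)) = comp5 t 1 p"
    "(case p of (l, a, i) \<Rightarrow> M3 t (l, a, i, 2)) = comp5 t (- 1) p"
    "(case p of (l, a, i) \<Rightarrow> M3 t (l, a, i, 3)) = {x. x \<in> comp5 t \<ii>\<^sub>5 p \<or> - x \<in> comp5 t \<ii>\<^sub>5 p}" for p
    by (cases p, simp only: prod.case M3_eq root5_def, simp)+
  then have 1: "(\<Union>p\<in>UNIV \<times> {0..5 ^ (t - 1) - 1} \<times> {1..4} \<times> {1..3}. M3 t p)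
      = (\<Union>p\<in>idx5 t. comp5 t 1 p) \<union> (\<Union>p\<in>idx5 t. comp5 t (- 1) p)
      \<union> (\<Union>p\<in>idx5 t. comp5 t \<ii>\<^sub>5 p) \<union> {x. - x \<in> (\<Union>p\<in>idx5 t. comp5 t \<ii>\<^sub>5 p)}"
    unfolding UN_quadruples 3 bex_simps
    by (intro set_eqI) (simp only: mem_Collect_eq Un_iff UN_iff bex_disj_distrib disj_assoc simp_thms)
  have "- x = \<ii>\<^sub>5 \<longleftrightarrow> x = - \<ii>\<^sub>5" for x by (metis minus_minus)
  then have 2: "{x. - x \<in> coset5 \<ii>\<^sub>5 1 - {\<ii>\<^sub>5}} = coset5 (- \<ii>\<^sub>5) 1 - {- \<ii>\<^sub>5}"
    unfolding Diff_iff neg_coset5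
    by (intro set_eqI) (simp only: mem_Collect_eq Diff_iff singleton_iff)
  show ?thesis
    unfolding 1 UN_comp5[OF assms] 2 roots5_def by (simp only: UN_insert UN_empty Un_empty_right Un_assoc)
qed

section \<open>Disjointness of the families with four indices\<close>

lemma disjoint_familyD:
  "disjoint_family_on A I \<Longrightarrow> p \<in> I \<Longrightarrow> p' \<in> I \<Longrightarrow> x \<in> A p \<Longrightarrow> x \<in> A p' \<Longrightarrow> p = p'"
  unfolding disjoint_family_on_def by blast

lemma disjoint_quadruplesI:
  assumes "\<And>l a i j l' a' i' j' x. (l, a, i) \<in> X \<times> Y \<times> Z \<Longrightarrow> (l', a', i') \<in> X \<times> Y \<times> Z \<Longrightarrow> j \<in> J \<Longrightarrow> j' \<in> J
    \<Longrightarrow> x \<in> F (l, a, i, j) \<Longrightarrow> x \<in> F (l', a', i', j') \<Longrightarrow> (l, a, i) = (l', a', i') \<and> j = j'"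
  shows "disjoint_family_on F (X \<times> Y \<times> Z \<times> J)"
  unfolding disjoint_family_on_def disjoint_iff
proof (intro ballI impI allI notI)
  fix p p' x assume p: "p \<in> X \<times> Y \<times> Z \<times> J" "p' \<in> X \<times> Y \<times> Z \<times> J" "p \<noteq> p'" "x \<in> F p" "x \<in> F p'"
  obtain l a i j where 1: "p = (l, a, i, j)" by (rule prod_cases4)
  obtain l' a' i' j' where 2: "p' = (l', a', i', j')" by (rule prod_cases4)
  have "(l, a, i) = (l', a', i') \<and> j = j'"
    using p(1,2,4,5) unfolding 1 2 by (intro assms) auto
  then show False using p(3) 1 2 by simp
qed

lemma disjoint_M1:
  assumes "t > 0"
  shows "disjoint_family_on (M1 t) (UNIV \<times> {0..5 ^ (t - 1) - 1} \<times> {1..4} \<times> {1..4})"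
proof (rule disjoint_quadruplesI)
  fix l a i j l' a' i' j' x
  assume p: "(l, a, i) \<in> idx5 t" "(l', a', i') \<in> idx5 t" and j: "j \<in> {1..4}" "j' \<in> {1..4}"
    and "x \<in> M1 t (l, a, i, j)" "x \<in> M1 t (l', a', i', j')"
  then have x: "x \<in> comp5 t (root5 j) (l, a, i)" "x \<in> comp5 t (root5 j') (l', a', i')"
    by (simp_all only: M1_eq)
  have "j = j'"
    using comp5_res[OF assms p(1) x(1)] comp5_res[OF assms p(2) x(2)]
    by (intro root5_props(3) j) (simp only:)
  then show "(l, a, i) = (l', a', i') \<and> j = j'"
    using disjoint_familyD[OF disjoint_comp5[OF assms] p x(1)] x(2) by (simp only: simp_thms)
qed

lemma disjoint_M3:
  assumes "t > 0"
  shows "disjoint_family_on (M3 t) (UNIV \<times> {0..5 ^ (t - 1) - 1} \<times> {1..4} \<times> {1..3})"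
proof (rule disjoint_quadruplesI)
  fix l a i j l' a' i' j' x
  assume p: "(l, a, i) \<in> idx5 t" "(l', a', i') \<in> idx5 t" and j: "j \<in> {1..3}" "j' \<in> {1..3}"
    and x: "x \<in> M3 t (l, a, i, j)" "x \<in> M3 t (l', a', i', j')"
  \<comment> \<open>The residues modulo 5 that occur in components of kind \<open>j\<close>. They
    are disjoint for different kinds, so a common point determines \<open>j\<close>.\<close>
  define T where "T j = (if j = 1 then {1} else if j = 2 then {4} else {2, 3 :: int})" for j :: nat
  have res_neg: "res (- x) 1 = 2 \<longleftrightarrow> res x 1 = 3" for x
    using neg_coset5[of x "\<ii>\<^sub>5" 1] unfolding mem_coset5_1 res_1_roots .
  have T: "res x 1 \<in> T j" if p: "(l, a, i) \<in> idx5 t" and x: "x \<in> M3 t (l, a, i, j)" for x l a i j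
  proof (cases "j \<in> {1, 2}")
    case True
    then have "res x 1 = res (root5 j) 1"
      using x by (intro comp5_res[OF assms p]) (simp only: M3_eq if_True)
    then show ?thesis using True unfolding T_def root5_def using res_1_roots by (auto simp del: One_nat_def)
  next
    case False
    then have "x \<in> comp5 t \<ii>\<^sub>5 (l, a, i) \<or> - x \<in> comp5 t \<ii>\<^sub>5 (l, a, i)"
      using x by (simp only: M3_eq if_False mem_Collect_eq)
    then have "res x 1 = 2 \<or> res (- x) 1 = 2"
      using comp5_res[OF assms p, of _ "\<ii>\<^sub>5"] unfolding res_1_roots by blast
    then show ?thesis using False unfolding res_neg T_def by simp
  qed
  have "{1..3} = {1, 2, 3 :: nat}" by auto
  then have jj: "j = j'"
    using T[OF p(1) x(1)] T[OF p(2) x(2)] j unfolding T_def by (auto simp del: One_nat_def split: if_splits)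
  note same = disjoint_familyD[OF disjoint_comp5[OF assms] p]
  have "(l, a, i) = (l', a', i')"
  proof (cases "j \<in> {1, 2}")
    case True
    then have "x \<in> comp5 t (root5 j) (l, a, i)" "x \<in> comp5 t (root5 j) (l', a', i')"
      using x unfolding jj by (simp_all only: M3_eq if_True)
    then show ?thesis by (rule same)
  next
    case False
    then have "x \<in> comp5 t \<ii>\<^sub>5 (l, a, i) \<or> - x \<in> comp5 t \<ii>\<^sub>5 (l, a, i)"
      "x \<in> comp5 t \<ii>\<^sub>5 (l', a', i') \<or> - x \<in> comp5 t \<ii>\<^sub>5 (l', a', i')"
      using x unfolding jj by (simp_all only: M3_eq if_False mem_Collect_eq)
    \<comment> \<open>The residues 2 and 3 are exchanged by negation, so a point and its negative
      are never both near \<open>\<ii>\<^sub>5\<close>. Hence both memberships concern the same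
      half.\<close>
    moreover have "\<not> (x \<in> comp5 t \<ii>\<^sub>5 q \<and> - x \<in> comp5 t \<ii>\<^sub>5 q')" if "q \<in> idx5 t" "q' \<in> idx5 t" for q q'
      using comp5_res[OF assms that(1), of x "\<ii>\<^sub>5"] comp5_res[OF assms that(2), of "- x" "\<ii>\<^sub>5"]
        res_neg[of x]
      unfolding res_1_roots by auto
    ultimately show ?thesis using same p by blast
  qed
  with jj show "(l, a, i) = (l', a', i') \<and> j = j'" by blast
qed

lemma even_power_square:
  assumes "even m" "\<not> 5 dvd x"
  shows "x ^ (m ^ 2) \<in> coset5 1 1"
proof -
  \<comment> \<open>An even \<open>m\<close> may be 2 modulo 4, but its square is divisible by 4, so
    Fermat applies after two iterations.\<close>
  obtain r where "m ^ 2 = 4 * r" using assms(1) by (auto simp: power2_eq_square elim!: evenE)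
  moreover have "res x 1 ^ 4 mod 5 = 1"
    using assms(2) res_1_cases[of x] unfolding dvd5_iff by auto
  then have "(res x 1 ^ 4) ^ r mod 5 = 1" 
    by (metis power_mod mod_pos_pos_trivial power_one zero_le_one one_less_numeral_iff
        semiring_norm(77))
  ultimately show ?thesis unfolding mem_coset5_1 res_power res_1_roots by (simp add: power_mult)
qed

lemma cosets_234: "coset5 2 1 \<union> coset5 3 1 \<union> coset5 4 1 = - coset5 0 1 - coset5 1 1"
proof (intro set_eqI)
  fix x
  have r: "res 2 1 = 2" "res 3 1 = 3" "res 4 1 = 4" by (simp_all add: res_numeral)
  show "x \<in> coset5 2 1 \<union> coset5 3 1 \<union> coset5 4 1 \<longleftrightarrow> x \<in> - coset5 0 1 - coset5 1 1"
    using res_1_cases[of x] unfolding Un_iff Diff_iff Compl_iff mem_coset5_1 res_1_roots r by auto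
qed

text \<open>Units enter the invariant coset of 1 after two steps. Multiples of 5 never come closer
  to it than 1/5, because they differ from its points modulo 5.\<close>

lemma attracting_basin_units:
  assumes "even m" "m \<ge> 2"
  shows "attracting_basin (\<lambda>x :: z5. x ^ m) (coset5 1 1) = - coset5 0 1"
proof (intro equalityI subsetI)
  fix x assume x: "x \<in> attracting_basin (\<lambda>x :: z5. x ^ m) (coset5 1 1)"
  have one: "1 \<in> coset5 1 1" unfolding mem_coset5 by simp
  have far: "infdist z (coset5 1 1) \<ge> 1 / 5" if "5 dvd z" for z
  proof -
    have "1 / 5 \<le> dist z y" if "y \<in> coset5 1 1" for y
    proof (rule ccontr)
      assume "\<not> 1 / 5 \<le> dist z y"
      then have "5 dvd z - y" using abs5_le_iff[of "z - y" 1] by (simp add: dist_z5_def)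
      then have "res z 1 = res y 1" by (simp only: dvd5_diff_iff)
      then have "res 1 1 = res 0 1"
        using \<open>5 dvd z\<close> \<open>y \<in> coset5 1 1\<close> unfolding mem_coset5_1 dvd5_iff res_1_roots by simp
      then show False unfolding res_1_roots by simp
    qed
    then show ?thesis
      using one by (subst infdist_notempty) (blast, intro cINF_greatest, blast)
  qed
  have "(\<lambda>n. infdist (x ^ (m ^ n)) (coset5 1 1)) \<longlonglongrightarrow> 0"
    using x unfolding attracting_basin_def funpow_power by blast
  then have "eventually (\<lambda>n. infdist (x ^ (m ^ n)) (coset5 1 1) < 1 / 5) sequentially"
    by (rule order_tendstoD) simp
  then obtain n where "infdist (x ^ (m ^ n)) (coset5 1 1) < 1 / 5"
    by (auto simp only: eventually_sequentially)
  then have "\<not> 5 dvd x ^ (m ^ n)" using far[of "x ^ (m ^ n)"] by linarith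
  then have "\<not> 5 dvd x" using assms by (simp add: dvd5_power_iff)
  then show "x \<in> - coset5 0 1" unfolding Compl_iff mem_coset5 by simp
next
  fix x assume "x \<in> - coset5 0 1"
  then have "\<not> 5 dvd x" unfolding Compl_iff mem_coset5 by simp
  then have "((\<lambda>x. x ^ m) ^^ 2) x \<in> coset5 1 1"
    unfolding funpow_power by (rule even_power_square[OF assms(1)])
  moreover have "y ^ m \<in> coset5 1 1" if "y \<in> coset5 1 1" for y
    using that unfolding mem_coset5_1 res_power res_1_roots by simp
  ultimately show "x \<in> attracting_basin (\<lambda>x. x ^ m) (coset5 1 1)"
    by (intro attracting_basin_absorb)
qed

lemma minimal_decomposition_even:
  assumes m2: "m \<ge> 2" and even: "even m" and t: "t > 0"
    and m: "m = 1 + 5 ^ t * q" and q: "\<not> 5 dvd q"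
  shows "minimal_decomposition (\<lambda>x. x ^ m) {0, 1} (idx5 t) (M2 t)
    ((coset5 0 1 - {0}) \<union> (coset5 2 1 \<union> coset5 3 1 \<union> coset5 4 1))"
proof -
  have others: "coset5 2 1 \<union> coset5 3 1 \<union> coset5 4 1 = - coset5 0 1 - coset5 1 1"
    by (rule cosets_234)
  have one: "1 \<in> coset5 1 1" and zero: "0 \<in> coset5 0 1" unfolding mem_coset5 by simp_all
  have disj: "coset5 0 1 \<inter> coset5 1 1 = {}"
    unfolding disjoint_iff mem_coset5_1 res_1_roots by simp
  have UN: "(\<Union>p\<in>idx5 t. M2 t p) = coset5 1 1 - {1}"
    unfolding M2_eq by (rule UN_comp5[OF t])
  have min: "minimal_component (\<lambda>x. x ^ m) (M2 t p)" if p: "p \<in> idx5 t" for p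
  proof -
    obtain l a i where lai: "p = (l, a, i)" by (rule prod_cases3)
    show ?thesis using p unfolding lai M2_eq by (intro minimal_comp5[OF t _ _ m q]) simp_all
  qed
  \<comment> \<open>Doubling the period makes the exponent divisible by 4, so a periodic root equals
    a power of \<open>x ^ 4 = 1\<close>.\<close>
  have "x = 1" if c: "x \<in> roots5" and "n > 0" "x ^ (m ^ n) = x" for x n
  proof -
    have "x ^ (m ^ (2 * n)) = x"
      using that(3) by (simp add: mult_2 power_add power_mult)
    moreover have "4 dvd m ^ (2 * n)"
    proof -
      have "2 ^ 2 dvd m ^ 2" using even by (rule dvd_power_same)
      moreover have "m ^ 2 dvd m ^ (2 * n)" using \<open>n > 0\<close> by (intro le_imp_power_dvd) simp
      ultimately show ?thesis using dvd_trans by fastforce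
    qed
    then obtain r where "m ^ (2 * n) = 4 * r" ..
    ultimately show ?thesis using roots5_pow4[OF c] by (simp add: power_mult)
  qed
  then have per: "{0, 1} = periodic_points (\<lambda>x :: z5. x ^ m)"
    unfolding periodic_points_power[OF m2] using m2 by (auto simp: roots5_def intro!: exI[of _ 1])
  have orbit: "periodic_orbit (\<lambda>x :: z5. x ^ m) 1 {0}" "periodic_orbit (\<lambda>x :: z5. x ^ m) 1 {1}"
    using m2 by (intro periodic_orbit_fixed; simp)+
  show ?thesis
    unfolding minimal_decomposition_def UN others
  proof (intro conjI ballI)
    show "{0, 1} \<union> (coset5 1 1 - {1}) \<union> (coset5 0 1 - {0} \<union> (- coset5 0 1 - coset5 1 1)) = UNIV"
      by blast
    show "{0, 1} \<inter> (coset5 1 1 - {1}) = {}" using zero disj by blast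
    show "{0, 1} \<inter> (coset5 0 1 - {0} \<union> (- coset5 0 1 - coset5 1 1)) = {}"
      using zero one disj by blast
    show "(coset5 1 1 - {1}) \<inter> (coset5 0 1 - {0} \<union> (- coset5 0 1 - coset5 1 1)) = {}"
      using disj by blast
    show "{0, 1} = periodic_points (\<lambda>x :: z5. x ^ m)" by (rule per)
    show "countable (idx5 t)" by simp
    show "disjoint_family_on (M2 t) (idx5 t)" unfolding M2_eq by (rule disjoint_comp5[OF t])
    show "minimal_component (\<lambda>x. x ^ m) (M2 t p)" if "p \<in> idx5 t" for p using that by (rule min)
  next
    fix x assume x: "x \<in> coset5 0 1 - {0} \<union> (- coset5 0 1 - coset5 1 1)"
    show "(\<exists>n A. periodic_orbit (\<lambda>x. x ^ m) n A \<and> x \<in> attracting_basin (\<lambda>x. x ^ m) A)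
        \<or> (\<exists>p\<in>idx5 t. x \<in> attracting_basin (\<lambda>x. x ^ m) (M2 t p))"
    proof (cases "x \<in> coset5 0 1")
      case True
      then have "x \<in> attracting_basin (\<lambda>x. x ^ m) {0}" by (simp only: attracting_basin_0[OF m2])
      then show ?thesis using orbit(1) by blast
    next
      case False
      then have "\<not> 5 dvd x" unfolding mem_coset5 by simp
      then have *: "((\<lambda>x. x ^ m) ^^ 2) x \<in> coset5 1 1"
        unfolding funpow_power by (rule even_power_square[OF even])
      \<comment> \<open>The second iterate lies in the coset of 1: it is either the fixed point 1
        itself or a point of some component.\<close>
      show ?thesis
      proof (cases "((\<lambda>x. x ^ m) ^^ 2) x = 1")
        case True
        then have "x \<in> attracting_basin (\<lambda>x. x ^ m) {1}"
          by (intro attracting_basin_absorb[of _ _ 2]) simp_all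
        then show ?thesis using orbit(2) by blast
      next
        case False
        then have "((\<lambda>x. x ^ m) ^^ 2) x \<in> (\<Union>p\<in>idx5 t. M2 t p)" using * unfolding UN by blast
        then obtain p where p: "p \<in> idx5 t" "((\<lambda>x. x ^ m) ^^ 2) x \<in> M2 t p" by blast
        have "y ^ m \<in> M2 t p" if "y \<in> M2 t p" for y
          using min[OF p(1)] that unfolding minimal_component_def by blast
        then have "x \<in> attracting_basin (\<lambda>x. x ^ m) (M2 t p)"
          using p(2) by (intro attracting_basin_absorb[of _ _ 2])
        then show ?thesis using p(1) by blast
      qed
    qed
  qed
qed

section \<open>The three congruence classes of the exponent\<close>

lemma minus_i5_neq: "\<ii>\<^sub>5 \<noteq> - \<ii>\<^sub>5"
proof
  assume "\<ii>\<^sub>5 = - \<ii>\<^sub>5"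
  then have "res \<ii>\<^sub>5 1 = res (- \<ii>\<^sub>5) 1" by (rule arg_cong)
  then show False unfolding res_1_roots by simp
qed

theorem theorem5p3:
  fixes m t :: nat and f :: "z5 \<Rightarrow> z5"
  assumes "m \<ge> 2" and "[m = 1] (mod 5)"
    and f_def: "f = (\<lambda>x. x ^ m)"
    and t_def: "t = multiplicity 5 (m - 1)"
  shows
    "([m = 1] (mod 20) \<longrightarrow>
        minimal_decomposition f
          {0, 1, - 1, \<ii>\<^sub>5, - \<ii>\<^sub>5}
          (UNIV \<times> {0..5 ^ (t - 1) - 1} \<times> {1..4} \<times> {1..4}) (M1 t)
          (coset5 0 1 - {0}) \<and>
        (\<forall>x\<in>{0, 1, - 1, \<ii>\<^sub>5, - \<ii>\<^sub>5}. f x = x) \<and>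
        attracting_basin f {0} - {0} = coset5 0 1 - {0})
     \<and> ([m = 6] (mod 10) \<longrightarrow>
        minimal_decomposition f
          {0, 1}
          (UNIV \<times> {0..5 ^ (t - 1) - 1} \<times> {1..4}) (M2 t)
          ((coset5 0 1 - {0}) \<union> (coset5 2 1 \<union> coset5 3 1 \<union> coset5 4 1)) \<and>
        (\<forall>x\<in>{0, 1}. f x = x) \<and>
        attracting_basin f {0} - {0} = coset5 0 1 - {0} \<and>
        attracting_basin f (coset5 1 1) - coset5 1 1 = coset5 2 1 \<union> coset5 3 1 \<union> coset5 4 1)
     \<and> ([m = 11] (mod 20) \<longrightarrow>
        minimal_decomposition f
          {0, 1, - 1, \<ii>\<^sub>5, - \<ii>\<^sub>5}
          (UNIV \<times> {0..5 ^ (t - 1) - 1} \<times> {1..4} \<times> {1..3}) (M3 t)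
          (coset5 0 1 - {0}) \<and>
        (\<forall>x\<in>{0, 1, - 1}. f x = x) \<and>
        periodic_orbit f 2 {\<ii>\<^sub>5, - \<ii>\<^sub>5} \<and>
        attracting_basin f {0} - {0} = coset5 0 1 - {0})"
proof -
  obtain q where q: "m - 1 = 5 ^ t * q" "\<not> 5 dvd q"
    using multiplicity_decompose'[of "m - 1" 5] assms(1) unfolding t_def by auto
  then have m: "m = 1 + 5 ^ t * q" using assms(1) by linarith
  have "5 dvd m - 1" using assms(1,2) by (metis cong_to_1_nat)
  then have t: "t > 0" using q by (cases t) auto
  have basin0: "attracting_basin f {0} - {0} = coset5 0 1 - {0}"
    unfolding f_def attracting_basin_0[OF assms(1)] ..
  have zero: "f 0 = 0" using assms(1) by (simp add: f_def)
  have i4: "\<ii>\<^sub>5 ^ 4 = 1" by (intro roots5_pow4) (simp add: roots5_def)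
  have count: "countable ((UNIV :: nat set) \<times> {0..5 ^ (t - 1) - 1 :: nat} \<times> {1..4 :: nat} \<times> J)"
    for J :: "nat set"
    by (rule countableI_type)
  have "minimal_decomposition f {0, 1, - 1, \<ii>\<^sub>5, - \<ii>\<^sub>5}
          (UNIV \<times> {0..5 ^ (t - 1) - 1} \<times> {1..4} \<times> {1..4}) (M1 t) (coset5 0 1 - {0}) \<and>
        (\<forall>x\<in>{0, 1, - 1, \<ii>\<^sub>5, - \<ii>\<^sub>5}. f x = x) \<and>
        attracting_basin f {0} - {0} = coset5 0 1 - {0}" if "[m = 1] (mod 20)"
  proof -
    \<comment> \<open>With \<open>m = 4 * r + 1\<close> the map fixes every fourth root of
      unity.\<close>
    define r where "r = 5 * (m div 20)"
    have "m mod 20 = 1" using that by (simp add: cong_def)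
    then have r: "m = 4 * r + 1" using mult_div_mod_eq[of 20 m] unfolding r_def by linarith
    have fix_root: "c ^ m = c" if "c \<in> roots5" for c
      using roots5_pow4[OF that] by (simp add: r power_add power_mult)
    have "minimal_decomposition f {0, 1, - 1, \<ii>\<^sub>5, - \<ii>\<^sub>5}
          (UNIV \<times> {0..5 ^ (t - 1) - 1} \<times> {1..4} \<times> {1..4}) (M1 t) (coset5 0 1 - {0})"
      unfolding f_def
    proof (rule minimal_decomposition_odd[OF assms(1) _ UN_M1[OF t] count disjoint_M1[OF t]])
      show "\<exists>n>0. c ^ (m ^ n) = c" if "c \<in> roots5" for c
        using fix_root[OF that] by (intro exI[of _ 1]) simp
      fix p :: "nat \<times> nat \<times> nat \<times> nat"
      assume p: "p \<in> UNIV \<times> {0..5 ^ (t - 1) - 1} \<times> {1..4} \<times> {1..4}"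
      obtain l a i j where lai: "p = (l, a, i, j)" by (rule prod_cases4)
      have "(l, a, i) \<in> idx5 t" "j \<in> {1..4}" using p unfolding lai by auto
      then show "minimal_component (\<lambda>x. x ^ m) (M1 t p)"
        unfolding lai M1_eq using root5_props(2)[of j]
        by (intro minimal_comp5[OF t _ _ m q(2)] roots5_pow4 fix_root)
    qed
    then show ?thesis using basin0 zero fix_root by (auto simp: f_def roots5_def)
  qed
  moreover have "minimal_decomposition f {0, 1} (idx5 t) (M2 t)
          ((coset5 0 1 - {0}) \<union> (coset5 2 1 \<union> coset5 3 1 \<union> coset5 4 1)) \<and>
        (\<forall>x\<in>{0, 1}. f x = x) \<and>
        attracting_basin f {0} - {0} = coset5 0 1 - {0} \<and>
        attracting_basin f (coset5 1 1) - coset5 1 1 = coset5 2 1 \<union> coset5 3 1 \<union> coset5 4 1"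
    if "[m = 6] (mod 10)"
  proof -
    have "m mod 10 = 6" using that by (simp add: cong_def)
    define k where "k = m div 10"
    have "m = 10 * k + 6"
      using mult_div_mod_eq[of 10 m] \<open>m mod 10 = 6\<close> unfolding k_def by linarith
    then have even: "even m" by simp
    show ?thesis
    proof (intro conjI)
      show "minimal_decomposition f {0, 1} (idx5 t) (M2 t)
          ((coset5 0 1 - {0}) \<union> (coset5 2 1 \<union> coset5 3 1 \<union> coset5 4 1))"
        unfolding f_def by (rule minimal_decomposition_even[OF assms(1) even t m q(2)])
      show "\<forall>x\<in>{0, 1}. f x = x" using zero by (auto simp: f_def)
      show "attracting_basin f (coset5 1 1) - coset5 1 1 = coset5 2 1 \<union> coset5 3 1 \<union> coset5 4 1"
        unfolding f_def attracting_basin_units[OF even assms(1)] by (rule cosets_234[symmetric])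
    qed (rule basin0)
  qed
  moreover have "minimal_decomposition f {0, 1, - 1, \<ii>\<^sub>5, - \<ii>\<^sub>5}
          (UNIV \<times> {0..5 ^ (t - 1) - 1} \<times> {1..4} \<times> {1..3}) (M3 t) (coset5 0 1 - {0}) \<and>
        (\<forall>x\<in>{0, 1, - 1}. f x = x) \<and>
        periodic_orbit f 2 {\<ii>\<^sub>5, - \<ii>\<^sub>5} \<and>
        attracting_basin f {0} - {0} = coset5 0 1 - {0}" if "[m = 11] (mod 20)"
  proof -
    define k where "k = m div 20"
    have "m mod 20 = 11" using that by (simp add: cong_def)
    then have "m = 20 * k + 11" using mult_div_mod_eq[of 20 m] unfolding k_def by linarith
    \<comment> \<open>As \<open>m\<close> is 3 modulo 4, the map inverts the roots: it fixes 1 and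
      -1 and exchanges \<open>\<ii>\<^sub>5\<close> with \<open>- \<ii>\<^sub>5\<close>.\<close>
    then have "m = 4 * (5 * k + 2) + 3" by simp
    then obtain r where r: "m = 4 * r + 3" ..
    have odd: "odd m" by (simp add: r)
    have i5m: "\<ii>\<^sub>5 ^ m = - \<ii>\<^sub>5"
      using i5_sq i4 by (simp add: r power_add power_mult power3_eq_cube power2_eq_square)
    have fix1: "root5 j ^ m = root5 j" if "j \<in> {1, 2}" for j using that odd by (auto simp: root5_def)
    have swap: "f \<ii>\<^sub>5 = - \<ii>\<^sub>5" "f (- \<ii>\<^sub>5) = \<ii>\<^sub>5" using i5m odd by (simp_all add: f_def)
    have "minimal_decomposition f {0, 1, - 1, \<ii>\<^sub>5, - \<ii>\<^sub>5}
          (UNIV \<times> {0..5 ^ (t - 1) - 1} \<times> {1..4} \<times> {1..3}) (M3 t) (coset5 0 1 - {0})"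
      unfolding f_def
    proof (rule minimal_decomposition_odd[OF assms(1) _ UN_M3[OF t] count disjoint_M3[OF t]])
      fix c assume c: "c \<in> roots5"
      \<comment> \<open>Two iterations return all four roots, whether fixed or exchanged.\<close>
      have "c ^ (m ^ 2) = c"
        using c i5m odd by (auto simp: roots5_def power2_eq_square power_mult)
      then show "\<exists>n>0. c ^ (m ^ n) = c" by (intro exI[of _ 2]) simp
    next
      fix p :: "nat \<times> nat \<times> nat \<times> nat"
      assume p: "p \<in> UNIV \<times> {0..5 ^ (t - 1) - 1} \<times> {1..4} \<times> {1..3}"
      obtain l a i j where lai: "p = (l, a, i, j)" by (rule prod_cases4)
      have p': "(l, a, i) \<in> idx5 t" using p unfolding lai by auto
      show "minimal_component (\<lambda>x. x ^ m) (M3 t p)"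
      proof (cases "j \<in> {1, 2}")
        case True
        then have "root5 j ^ 4 = 1" by (intro roots5_pow4) (auto simp: roots5_def root5_def)
        then show ?thesis
          using minimal_comp5[OF t p' _ m q(2) fix1[OF True]] True by (simp only: lai M3_eq if_True)
      next
        case False
        then show ?thesis
          using minimal_comp5_swap[OF t p' i4 m q(2) i5m odd] by (simp only: lai M3_eq if_False)
      qed
    qed
    moreover have "periodic_orbit f 2 {\<ii>\<^sub>5, - \<ii>\<^sub>5}"
      unfolding periodic_orbit_def
      using minus_i5_neq swap
      by (auto intro!: exI[of _ "\<ii>\<^sub>5"] simp: numeral_2_eq_2 lessThan_Suc)
    moreover have "\<forall>x\<in>{0, 1, - 1}. f x = x" using zero odd by (auto simp: f_def)
    ultimately show ?thesis using basin0 by blast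
  qed
  ultimately show ?thesis by blast
qed

end
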